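(* Let $\mathbb{K}$ be a field, let $I$ be a square-free monomial ideal of $R=\mathbb{K}[x_1,\ldots,x_n]$, and let $\Delta=\Delta(I)$ be the simplicial complex associated with $I$. \begin{enumerate} \item[$(i)$] Suppose that $\mathrm{reg}(I)\le r$ and $\mathrm{pd}(I)\le n-r+1$. \begin{enumerate} \item[$(a)$] If $r$ is even and $\widetilde{\chi}(\Delta)>0$, then $\mathrm{reg}(I)=r$. \item[$(b)$] If $r$ is odd and $\widetilde{\chi}(\Delta)<0$, then $\mathrm{reg}(I)=r$. \end{enumerate} \item[$(ii)$] Suppose that $\mathrm{reg}(I)\le r$ and $\mathrm{pd}(I)\le n-r$. If $\widetilde{\chi}(\Delta)\neq 0$, then $\mathrm{reg}(I)=r$. \end{enumerate}
   Context: The ring $R=\mathbb{K}[x_1,\ldots,x_n]$ has the standard grading ($\deg x_i=1$), and $\beta_{i,j}(I)$ denotes the graded Betti number of $I$, i.e. the number of minimal generators of degree $j$ in the $i$-th syzygy module of $I$ (the number of summands $R(-j)$ in homological position $i$ of the minimal graded free resolution of $I$, with $i=0$ corresponding to the generators of $I$). The Castelnuovo-Mumford regularity and projective dimension of $I$ are $\mathrm{reg}(I)=\max\{j-i\mid \beta_{i,j}(I)\ne 0\}$ and $\mathrm{pd}(I)=\max\{i\mid \beta_{i,j}(I)\neq 0 \text{ for some } j\}$. The simplicial complex associated with $I$ is $\Delta(I)=\{\{x_{i_1},\ldots,x_{i_r}\}\mid \text{the square-free monomial } x_{i_1}\cdots x_{i_r}\notin I\}$. The reduced Euler characteristic of a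 simplicial complex $\Delta$ of dimension $D$ is $\widetilde{\chi}(\Delta)=\sum_{i=-1}^{D}(-1)^i f_i=\sum_{i=-1}^{D}(-1)^i\dim_{\mathbb{K}}\widetilde{H}_i(\Delta;\mathbb{K})$, where $f_i$ is the number of faces of dimension $i$ (a face $F$ has dimension $|F|-1$, and $f_{-1}=1$ counts the empty face) and $\widetilde{H}_i(\Delta;\mathbb{K})$ is the $i$-th reduced simplicial homology. *)

theory Defs
  imports "HOL-Library.Poly_Mapping" "HOL-Library.Extended_Real" "HOL-Library.Cardinality"
begin

(* The polynomial ring over 'k with one variable for each element of the finite index type 'n;
   a monomial is given by its exponent vector 'n \<Rightarrow>\<^sub>0 nat. *)
type_synonym ('n, 'k) mpoly = "('n \<Rightarrow>\<^sub>0 nat) \<Rightarrow>\<^sub>0 'k"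

definition var :: "'n \<Rightarrow> ('n, 'k::field) mpoly" where
  "var v = Poly_Mapping.single (Poly_Mapping.single v 1) 1"

definition monom_deg :: "('n::finite \<Rightarrow>\<^sub>0 nat) \<Rightarrow> nat" where
  "monom_deg m = (\<Sum>v\<in>UNIV. Poly_Mapping.lookup m v)"

(* A ring is regarded as a module over itself, so that ideals are the subspaces of
   this module structure and module.span yields the ideal generated by a set. *)
lemma module_mult: "module ((*) :: 'a::comm_ring_1 \<Rightarrow> 'a \<Rightarrow> 'a)"
  by unfold_locales (simp_all add: algebra_simps)

definition graded_maximal_ideal :: "('n, 'k::field) mpoly set" where
  "graded_maximal_ideal = module.span (*) (range var)"


section \<open>Square-free monomial ideals and simplicial complexes\<close>

definition squarefree_monom :: "'n::finite set \<Rightarrow> ('n, 'k::field) mpoly" where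
  "squarefree_monom F = (\<Prod>v\<in>F. var v)"

definition squarefree_monomial_ideal :: "('n::finite, 'k::field) mpoly set \<Rightarrow> bool" where
  "squarefree_monomial_ideal I \<longleftrightarrow> (\<exists>\<F>. I = module.span (*) (squarefree_monom ` \<F>))"

definition associated_complex :: "('n::finite, 'k::field) mpoly set \<Rightarrow> 'n set set" where
  "associated_complex I = {F. squarefree_monom F \<notin> I}"

definition face_dim :: "'n set \<Rightarrow> int" where
  "face_dim F = int (card F) - 1"

definition complex_dim :: "'n set set \<Rightarrow> int" where
  "complex_dim \<Delta> = Max (face_dim ` \<Delta>)"

definition face_number :: "'n set set \<Rightarrow> int \<Rightarrow> nat" where
  "face_number \<Delta> i = card {F \<in> \<Delta>. face_dim F = i}"

(* For the void complex all face numbers vanish, so the sum is 0 although complex_dim is then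
   the unspecified value Max {}. *)
definition reduced_euler_char :: "'n set set \<Rightarrow> int" where
  "reduced_euler_char \<Delta> =
     (\<Sum>i = -1..complex_dim \<Delta>. (if even i then 1 else -1) * int (face_number \<Delta> i))"


section \<open>Graded free modules\<close>

(* The free module with basis (e_b), b \<in> B, consists of the finitely supported coefficient
   vectors nat \<Rightarrow>\<^sub>0 ('n, 'k) mpoly with support in B.  If e_b has degree d b, this is the
   direct sum of the R(- d b). *)

definition smult_vec :: "('n, 'k::field) mpoly \<Rightarrow> (nat \<Rightarrow>\<^sub>0 ('n, 'k) mpoly) \<Rightarrow> (nat \<Rightarrow>\<^sub>0 ('n, 'k) mpoly)" where
  "smult_vec p v = Poly_Mapping.map ((*) p) v"

definition free_module :: "nat set \<Rightarrow> (nat \<Rightarrow>\<^sub>0 ('n, 'k::field) mpoly) set" where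
  "free_module B = {v. Poly_Mapping.keys v \<subseteq> B}"

definition homogeneous :: "nat \<Rightarrow> ('n::finite, 'k::field) mpoly \<Rightarrow> bool" where
  "homogeneous j p \<longleftrightarrow> (\<forall>m\<in>Poly_Mapping.keys p. monom_deg m = j)"

definition homogeneous_vec :: "(nat \<Rightarrow> nat) \<Rightarrow> nat \<Rightarrow> (nat \<Rightarrow>\<^sub>0 ('n::finite, 'k::field) mpoly) \<Rightarrow> bool" where
  "homogeneous_vec d j v \<longleftrightarrow>
     (\<forall>b. \<forall>m\<in>Poly_Mapping.keys (Poly_Mapping.lookup v b). monom_deg m + d b = j)"

(* The R-linear map with e_b \<mapsto> g b, into a module with scalar multiplication s. *)
definition linear_ext ::
  "(('n, 'k::field) mpoly \<Rightarrow> 'm \<Rightarrow> 'm) \<Rightarrow> (nat \<Rightarrow> 'm) \<Rightarrow> (nat \<Rightarrow>\<^sub>0 ('n, 'k) mpoly) \<Rightarrow> 'm::ab_group_add" where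
  "linear_ext s g v = (\<Sum>b\<in>Poly_Mapping.keys v. s (Poly_Mapping.lookup v b) (g b))"


section \<open>Minimal graded free resolutions\<close>

(* A sequence  ... \<rightarrow> F_2 \<rightarrow> F_1 \<rightarrow> F_0 \<rightarrow> R  of graded free modules: gens i indexes a basis of F_i,
   shift i b is the degree of the basis element b of F_i, aug b is the image of the basis
   element b of F_0, and bdry i b \<in> F_i is the image of the basis element b of F_(i+1). *)
record (overloaded) ('n, 'k) free_seq =
  gens :: "nat \<Rightarrow> nat set"
  shift :: "nat \<Rightarrow> nat \<Rightarrow> nat"
  aug :: "nat \<Rightarrow> ('n, 'k) mpoly"
  bdry :: "nat \<Rightarrow> nat \<Rightarrow> (nat \<Rightarrow>\<^sub>0 ('n, 'k) mpoly)"

definition term_mod :: "('n, 'k::field) free_seq \<Rightarrow> nat \<Rightarrow> (nat \<Rightarrow>\<^sub>0 ('n, 'k) mpoly) set" where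
  "term_mod F i = free_module (gens F i)"

definition aug_map :: "('n, 'k::field) free_seq \<Rightarrow> (nat \<Rightarrow>\<^sub>0 ('n, 'k) mpoly) \<Rightarrow> ('n, 'k) mpoly" where
  "aug_map F = linear_ext (*) (aug F)"

(* The map F_(i+1) \<rightarrow> F_i. *)
definition bdry_map ::
  "('n, 'k::field) free_seq \<Rightarrow> nat \<Rightarrow> (nat \<Rightarrow>\<^sub>0 ('n, 'k) mpoly) \<Rightarrow> (nat \<Rightarrow>\<^sub>0 ('n, 'k) mpoly)" where
  "bdry_map F i = linear_ext smult_vec (bdry F i)"

(* Only finitely many generators in each degree are required; for the minimal resolution of an
   ideal, finite generation of the modules F_i is then a consequence of Hilbert's basis theorem.
   Generator degrees of such a resolution are never negative, so they are natural numbers. *)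
definition graded_free_resolution ::
  "('n::finite, 'k::field) free_seq \<Rightarrow> ('n, 'k) mpoly set \<Rightarrow> bool" where
  "graded_free_resolution F I \<longleftrightarrow>
     (\<forall>i j. finite {b \<in> gens F i. shift F i b = j}) \<and>
     (\<forall>b\<in>gens F 0. homogeneous (shift F 0 b) (aug F b)) \<and>
     (\<forall>i. \<forall>b\<in>gens F (Suc i).
        bdry F i b \<in> term_mod F i \<and> homogeneous_vec (shift F i) (shift F (Suc i) b) (bdry F i b)) \<and>
     aug_map F ` term_mod F 0 = I \<and>
     {v \<in> term_mod F 0. aug_map F v = 0} = bdry_map F 0 ` term_mod F 1 \<and>
     (\<forall>i. {v \<in> term_mod F (Suc i). bdry_map F i v = 0} = bdry_map F (Suc i) ` term_mod F (Suc (Suc i)))"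

(* Minimality: the image of F_(i+1) lies in \<mm> F_i for the graded maximal ideal \<mm>,
   that is, all its coefficients lie in \<mm>. *)
definition minimal_graded_free_resolution ::
  "('n::finite, 'k::field) free_seq \<Rightarrow> ('n, 'k) mpoly set \<Rightarrow> bool" where
  "minimal_graded_free_resolution F I \<longleftrightarrow>
     graded_free_resolution F I \<and>
     (\<forall>i. \<forall>v\<in>bdry_map F i ` term_mod F (Suc i).
        \<forall>b. Poly_Mapping.lookup v b \<in> graded_maximal_ideal)"

(* The minimal graded free resolution exists for homogeneous ideals and is unique up to
   isomorphism, so the choice of a representative does not affect the count. *)
definition betti :: "('n::finite, 'k::field) mpoly set \<Rightarrow> nat \<Rightarrow> nat \<Rightarrow> nat" where
  "betti I i j =
     (let F = (SOME F. minimal_graded_free_resolution F I)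
      in card {b \<in> gens F i. shift F i b = j})"

(* The suprema are taken in the extended reals.  For a nonzero homogeneous ideal the sets are
   finite and nonempty, so these are maxima; for the zero ideal they are empty and both
   invariants are -\<infinity>. *)
definition regularity :: "('n::finite, 'k::field) mpoly set \<Rightarrow> ereal" where
  "regularity I = Sup {ereal (real j - real i) | i j. betti I i j \<noteq> 0}"

definition proj_dim :: "('n::finite, 'k::field) mpoly set \<Rightarrow> ereal" where
  "proj_dim I = Sup {ereal (real i) | i. \<exists>j. betti I i j \<noteq> 0}"

end

(* Hochster's formula for the full multidegree would give the theorem at once, but its alternating
   sum suffices.  In a minimal graded free resolution the generators in homological position i have
   degree at least i, so in each degree only finitely many terms contribute, and rank-nullity turns
   exactness into K(t) H(t) = H_I(t), where K(t) is the sum of (-1)^i beta_{i,j} t^j and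
   H(t) = 1/(1 - t)^n.  The series of the monomials with support F is (t/(1 - t))^|F|, and I is
   spanned by the monomials whose support is not a face; comparing coefficients of t^n gives
   chi(Delta) = sum_i (-1)^(n+i) beta_{i,n}.  If reg(I) < r, then beta_{i,n} can be nonzero only for
   i > n - r, so the bound on pd(I) leaves at most i = n - r + 1, which fixes the sign.
   Since the Betti numbers refer to a chosen minimal resolution, one has to be constructed: iterate
   minimal covers, obtained from graded Nakayama, of the successive syzygy modules. *)

theory Submission
  imports Defs "HOL-Computational_Algebra.Formal_Power_Series"
begin

text \<open>Why the coefficient of t^n: multiplied by (1 - t)^n, the series of the monomials with
  support F becomes t^|F| (1 - t)^(n - |F|), a polynomial of degree exactly n with leading
  coefficient (-1)^(n - |F|). This one coefficient thus records the sign of each face, while the sum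
  over all subsets F collapses to the constant 1, which does not reach degree n > 0. On the Betti
  side, a nonzero beta_{i,n} gives n - i <= reg(I), hence i > n - r as soon as reg(I) < r. At the
  surviving index i = n - r + 1 the sign is (-1)^(n+i) = (-1)^(r+1); this is the origin of the
  parity cases. The ideal is treated as a submodule of a free module of rank one, so that the
  augmentation is a map of the same kind as the boundary maps and all stages are handled by one
  notion of cover. Minimality enters as the absence of constant coefficients in relations: it makes
  degrees grow by at least one per stage, which cuts off the alternating sum of dimensions.\<close>

section \<open>Vectors of polynomials\<close>

abbreviation coeff_vec :: "(nat \<Rightarrow>\<^sub>0 ('n \<Rightarrow>\<^sub>0 nat) \<Rightarrow>\<^sub>0 'k::zero) \<Rightarrow> nat \<Rightarrow> ('n \<Rightarrow>\<^sub>0 nat) \<Rightarrow> 'k" where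
  "coeff_vec v b m \<equiv> Poly_Mapping.lookup (Poly_Mapping.lookup v b) m"

abbreviation monom_vec :: "nat \<Rightarrow> ('n \<Rightarrow>\<^sub>0 nat) \<Rightarrow> 'k::zero \<Rightarrow> (nat \<Rightarrow>\<^sub>0 ('n \<Rightarrow>\<^sub>0 nat) \<Rightarrow>\<^sub>0 'k)" where
  "monom_vec b m c \<equiv> Poly_Mapping.single b (Poly_Mapping.single m c)"

lemma vec_eqI: "(\<And>b m. coeff_vec u b m = coeff_vec v b m) \<Longrightarrow> u = v"
  by (simp add: poly_mapping_eqI)

lemma lookup_smult_vec [simp]:
  "Poly_Mapping.lookup (smult_vec p v) b = p * Poly_Mapping.lookup v b"
  by (simp add: smult_vec_def Poly_Mapping.map.rep_eq when_def)

lemma module_smult_vec: "module smult_vec"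
  by unfold_locales (auto intro!: poly_mapping_eqI simp: lookup_add algebra_simps)

interpretation vec: module smult_vec
  by (rule module_smult_vec)

lemma smult_vec_single [simp]: "smult_vec p (Poly_Mapping.single b q) = Poly_Mapping.single b (p * q)"
  by (simp add: smult_vec_def)

lemma lookup_const_mult [simp]:
  fixes p :: "('n, 'k::field) mpoly"
  shows "Poly_Mapping.lookup (Poly_Mapping.single 0 c * p) m = c * Poly_Mapping.lookup p m"
  by (simp add: mult_map_scale_conv_mult[symmetric] Poly_Mapping.map.rep_eq when_def)

lemma poly_mapping_sum_monoms:
  assumes "finite A" "Poly_Mapping.keys p \<subseteq> A"
  shows "p = (\<Sum>m\<in>A. Poly_Mapping.single m (Poly_Mapping.lookup p m))"
  using assms
  by (intro poly_mapping_eqI)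
    (auto simp: lookup_sum lookup_single when_def sum.delta in_keys_iff subset_iff)

section \<open>Free modules\<close>

text \<open>\<open>linear_ext\<close> sums over the keys of its own argument, so sums for different
  vectors have different index sets. Passing to a common finite superset turns additivity into a
  termwise identity.\<close>

lemma linear_ext_superset:
  assumes "module s" "finite A" "Poly_Mapping.keys v \<subseteq> A"
  shows "linear_ext s g v = (\<Sum>b\<in>A. s (Poly_Mapping.lookup v b) (g b))"
proof -
  interpret module s by fact
  show ?thesis unfolding linear_ext_def
    by (rule sum.mono_neutral_left) (use assms(2,3) in \<open>auto simp: in_keys_iff\<close>)
qed

lemma linear_ext_add:
  assumes "module s"
  shows "linear_ext s g (u + v) = linear_ext s g u + linear_ext s g v"
proof -
  interpret module s by fact
  let ?A = "Poly_Mapping.keys u \<union> Poly_Mapping.keys v"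
  have k: "Poly_Mapping.keys (u + v) \<subseteq> ?A" by (rule Poly_Mapping.keys_add)
  show ?thesis
    by (simp add: linear_ext_superset[OF assms, of ?A] k lookup_add scale_left_distrib sum.distrib)
qed

lemma linear_ext_0 [simp]: "linear_ext s g 0 = 0"
  by (simp add: linear_ext_def)

lemma linear_ext_smult:
  assumes "module s"
  shows "linear_ext s g (smult_vec p v) = s p (linear_ext s g v)"
proof -
  interpret module s by fact
  have k: "Poly_Mapping.keys (smult_vec p v) \<subseteq> Poly_Mapping.keys v" by (auto simp: in_keys_iff)
  show ?thesis
    by (simp add: linear_ext_superset[OF assms, of "Poly_Mapping.keys v"] k scale_sum_right)
qed

lemma linear_ext_single:
  assumes "module s"
  shows "linear_ext s g (Poly_Mapping.single b p) = s p (g b)"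
proof -
  interpret module s by fact
  show ?thesis by (simp add: linear_ext_superset[OF assms, of "{b}"])
qed

lemma linear_ext_sum:
  assumes "module s"
  shows "linear_ext s g (sum f A) = (\<Sum>a\<in>A. linear_ext s g (f a))"
  by (induction A rule: infinite_finite_induct) (simp_all add: linear_ext_add[OF assms])

lemma mem_free_module_iff: "v \<in> free_module B \<longleftrightarrow> (\<forall>b. b \<notin> B \<longrightarrow> Poly_Mapping.lookup v b = 0)"
  by (auto simp: free_module_def in_keys_iff subset_iff)

lemma subspace_free_module: "vec.subspace (free_module B)"
  by (auto simp: vec.subspace_def mem_free_module_iff lookup_add)

abbreviation mvec_map :: "(nat \<Rightarrow> (nat \<Rightarrow>\<^sub>0 ('n, 'k::field) mpoly)) \<Rightarrow> (nat \<Rightarrow>\<^sub>0 ('n, 'k) mpoly) \<Rightarrow> (nat \<Rightarrow>\<^sub>0 ('n, 'k) mpoly)" where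
  "mvec_map \<equiv> linear_ext smult_vec"

lemma module_hom_mvec_map: "module_hom smult_vec smult_vec (mvec_map g)"
  by (intro module_hom.intro module_smult_vec module_hom_axioms.intro)
    (simp_all add: linear_ext_add linear_ext_smult module_smult_vec)

interpretation mvec_map: module_hom smult_vec smult_vec "mvec_map g" for g
  by (rule module_hom_mvec_map)

lemma mvec_map_mem:
  assumes "vec.subspace M" "v \<in> free_module B" "\<And>b. b \<in> B \<Longrightarrow> g b \<in> M"
  shows "mvec_map g v \<in> M"
  unfolding linear_ext_def
  by (intro vec.subspace_sum vec.subspace_scale) (use assms in \<open>auto simp: free_module_def\<close>)

section \<open>Gradings\<close>

lemma monom_deg_add: "monom_deg (a + b) = monom_deg a + monom_deg b"
  by (simp add: monom_deg_def lookup_add sum.distrib)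

lemma monom_deg_0 [simp]: "monom_deg 0 = 0"
  by (simp add: monom_deg_def)

lemma monom_deg_eq_0_iff: "monom_deg m = 0 \<longleftrightarrow> m = 0"
  by (auto simp: monom_deg_def intro: poly_mapping_eqI)

lemma monom_deg_single [simp]: "monom_deg (Poly_Mapping.single x c) = c"
  by (simp add: monom_deg_def lookup_single when_def)

lemma homogeneous_vec_iff:
  "homogeneous_vec d j v \<longleftrightarrow> (\<forall>b m. coeff_vec v b m \<noteq> 0 \<longrightarrow> monom_deg m + d b = j)"
  by (auto simp: homogeneous_vec_def in_keys_iff)

lemma homogeneous_vec_smult:
  assumes "homogeneous e p" "homogeneous_vec d j v"
  shows "homogeneous_vec d (e + j) (smult_vec p v)"
  unfolding homogeneous_vec_def
proof (intro allI ballI)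
  fix b m assume "m \<in> Poly_Mapping.keys (Poly_Mapping.lookup (smult_vec p v) b)"
  then have "m \<in> Poly_Mapping.keys (p * Poly_Mapping.lookup v b)" by simp
  then obtain x y where "m = x + y" "x \<in> Poly_Mapping.keys p" "y \<in> Poly_Mapping.keys (Poly_Mapping.lookup v b)"
    using keys_mult by blast
  then show "monom_deg m + d b = e + j"
    using assms by (auto simp: homogeneous_def homogeneous_vec_def monom_deg_add)
qed

lemma homogeneous_vec_0 [simp]: "homogeneous_vec d j 0"
  by (simp add: homogeneous_vec_iff)

lemma homogeneous_vec_add:
  "homogeneous_vec d j u \<Longrightarrow> homogeneous_vec d j v \<Longrightarrow> homogeneous_vec d j (u + v)"
  unfolding homogeneous_vec_iff by (metis add_0 lookup_add)

lemma homogeneous_vec_sum: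
  "(\<And>a. a \<in> A \<Longrightarrow> homogeneous_vec d j (f a)) \<Longrightarrow> homogeneous_vec d j (sum f A)"
  by (induction A rule: infinite_finite_induct) (simp_all add: homogeneous_vec_add)

lemma homogeneous_const [simp]: "homogeneous 0 (Poly_Mapping.single 0 c)"
  by (simp add: homogeneous_def)

text \<open>The component of degree \<open>j\<close>. The explicit finite sum makes finite support
  automatic; afterwards only the coefficient formula \<open>lookup_homog_part\<close> is
  used.\<close>

definition homog_part :: "(nat \<Rightarrow> nat) \<Rightarrow> nat \<Rightarrow> (nat \<Rightarrow>\<^sub>0 ('n::finite, 'k::field) mpoly) \<Rightarrow> (nat \<Rightarrow>\<^sub>0 ('n, 'k) mpoly)" where
  "homog_part d j v = (\<Sum>b\<in>Poly_Mapping.keys v.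
     \<Sum>m\<in>{m \<in> Poly_Mapping.keys (Poly_Mapping.lookup v b). monom_deg m + d b = j}.
       monom_vec b m (coeff_vec v b m))"

lemma lookup_homog_part [simp]:
  "coeff_vec (homog_part d j v) b m = (if monom_deg m + d b = j then coeff_vec v b m else 0)"
proof -
  have "coeff_vec (homog_part d j v) b m = (\<Sum>b'\<in>Poly_Mapping.keys v. if b' = b then
     (\<Sum>m'\<in>{m \<in> Poly_Mapping.keys (Poly_Mapping.lookup v b). monom_deg m + d b = j}.
        if m' = m then coeff_vec v b m else 0) else 0)"
    unfolding homog_part_def lookup_sum
    by (rule sum.cong[OF refl]) (auto simp: lookup_single when_def lookup_sum intro!: sum.cong)
  also have "\<dots> = (if monom_deg m + d b = j then coeff_vec v b m else 0)"
    by (auto simp: in_keys_iff)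
  finally show ?thesis .
qed

lemma homogeneous_vec_homog_part: "homogeneous_vec d j (homog_part d j v)"
  by (auto simp: homogeneous_vec_iff)

lemma homog_part_of_homogeneous:
  "homogeneous_vec d i v \<Longrightarrow> homog_part d j v = (if i = j then v else 0)"
  by (rule vec_eqI) (auto simp: homogeneous_vec_iff)

lemma homog_part_free_module: "v \<in> free_module B \<Longrightarrow> homog_part d j v \<in> free_module B"
  by (auto simp: mem_free_module_iff intro!: poly_mapping_eqI)

lemma homog_part_0 [simp]: "homog_part d j 0 = 0"
  by (rule vec_eqI) simp

lemma homog_part_add: "homog_part d j (u + v) = homog_part d j u + homog_part d j v"
  by (rule vec_eqI) (auto simp: lookup_add)

lemma homog_part_sum: "homog_part d j (sum f A) = (\<Sum>a\<in>A. homog_part d j (f a))"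
  by (induction A rule: infinite_finite_induct) (simp_all add: homog_part_add)

lemma sum_homog_parts:
  fixes v :: "nat \<Rightarrow>\<^sub>0 ('n::finite, 'k::field) mpoly"
  obtains J where "finite J" "v = (\<Sum>j\<in>J. homog_part d j v)"
proof -
  \<comment> \<open>The degrees that actually occur in \<open>v\<close>; each nonzero term is
    counted in exactly one component.\<close>
  let ?J = "\<Union>b\<in>Poly_Mapping.keys v. (\<lambda>m. monom_deg m + d b) ` Poly_Mapping.keys (Poly_Mapping.lookup v b)"
  have fin: "finite ?J" by simp
  have "v = (\<Sum>j\<in>?J. homog_part d j v)"
  proof (rule vec_eqI)
    fix b m
    have "coeff_vec (\<Sum>j\<in>?J. homog_part d j v) b m = (\<Sum>j\<in>?J. if monom_deg m + d b = j then coeff_vec v b m else 0)"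
      by (simp add: lookup_sum)
    also have "\<dots> = (if monom_deg m + d b \<in> ?J then coeff_vec v b m else 0)"
      by (rule sum.delta'[OF fin])
    also have "\<dots> = coeff_vec v b m"
    proof (cases "coeff_vec v b m = 0")
      case False
      then have "m \<in> Poly_Mapping.keys (Poly_Mapping.lookup v b)" "b \<in> Poly_Mapping.keys v"
        by (auto simp: in_keys_iff)
      then have "monom_deg m + d b \<in> ?J" by blast
      then show ?thesis by (simp only: if_True)
    qed (simp only: if_cancel)
    finally show "coeff_vec v b m = coeff_vec (\<Sum>j\<in>?J. homog_part d j v) b m" by (rule sym)
  qed
  with fin show thesis by (rule that)
qed

text \<open>A nonzero coefficient exhibits a monomial whose degree accounts for the difference, so
  the truncated subtraction \<open>j - d b\<close> is a true one.\<close>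

lemma homogeneous_coeff_of_homogeneous_vec:
  assumes "homogeneous_vec d j v" "Poly_Mapping.lookup v b \<noteq> 0"
  shows "d b \<le> j" "homogeneous (j - d b) (Poly_Mapping.lookup v b)"
proof -
  from assms(2) obtain m where "m \<in> Poly_Mapping.keys (Poly_Mapping.lookup v b)"
    by (metis all_not_in_conv keys_eq_empty)
  with assms(1) have "monom_deg m + d b = j" by (simp add: homogeneous_vec_def)
  then show "d b \<le> j" by simp
  show "homogeneous (j - d b) (Poly_Mapping.lookup v b)"
    unfolding homogeneous_def
  proof
    fix m assume "m \<in> Poly_Mapping.keys (Poly_Mapping.lookup v b)"
    with assms(1) have "monom_deg m + d b = j" by (simp add: homogeneous_vec_def)
    then show "monom_deg m = j - d b" by simp
  qed
qed

lemma homogeneous_vec_mvec_map: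
  assumes "v \<in> free_module B" "homogeneous_vec d' j v"
    and "\<And>b. b \<in> B \<Longrightarrow> homogeneous_vec d (d' b) (g b)"
  shows "homogeneous_vec d j (mvec_map g v)"
  unfolding linear_ext_def
proof (rule homogeneous_vec_sum)
  fix b assume b: "b \<in> Poly_Mapping.keys v"
  then have "homogeneous_vec d (d' b) (g b)" using assms by (auto simp: free_module_def)
  with homogeneous_coeff_of_homogeneous_vec[OF assms(2), of b] b
  show "homogeneous_vec d j (smult_vec (Poly_Mapping.lookup v b) (g b))"
    using homogeneous_vec_smult[of "j - d' b" "Poly_Mapping.lookup v b" d "d' b" "g b"]
    by (simp add: in_keys_iff)
qed

text \<open>The map preserves degrees, so it sends the decomposition of \<open>v\<close> into
  components to that of its image. Hence kernels of such maps are graded, and a homogeneous element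
  of the image has a homogeneous preimage.\<close>

lemma homog_part_mvec_map:
  assumes v: "v \<in> free_module B"
    and g: "\<And>b. b \<in> B \<Longrightarrow> homogeneous_vec d (d' b) (g b)"
  shows "homog_part d j (mvec_map g v) = mvec_map g (homog_part d' j v)"
proof -
  obtain J where J: "finite J" "v = (\<Sum>i\<in>J. homog_part d' i v)" by (rule sum_homog_parts)
  have h: "homogeneous_vec d i (mvec_map g (homog_part d' i v))" for i
    by (intro homogeneous_vec_mvec_map[of _ B d'] homog_part_free_module v homogeneous_vec_homog_part g)
  have "homog_part d j (mvec_map g v) = homog_part d j (mvec_map g (\<Sum>i\<in>J. homog_part d' i v))"
    using J by simp
  also have "\<dots> = (\<Sum>i\<in>J. if i = j then mvec_map g (homog_part d' j v) else 0)"
    by (auto simp: linear_ext_sum[OF module_smult_vec] homog_part_sum homog_part_of_homogeneous[OF h] intro!: sum.cong)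
  also have "\<dots> = (\<Sum>i\<in>J. mvec_map g (homog_part d' j (homog_part d' i v)))"
    by (auto simp: homog_part_of_homogeneous[OF homogeneous_vec_homog_part] intro!: sum.cong)
  also have "\<dots> = mvec_map g (homog_part d' j (\<Sum>i\<in>J. homog_part d' i v))"
    by (simp add: linear_ext_sum[OF module_smult_vec] homog_part_sum)
  finally show ?thesis using J by simp
qed

section \<open>Dimensions of graded pieces\<close>

text \<open>\<open>G\<close> is a basis of \<open>V\<close> modulo the span of \<open>N\<close>:
  extend a maximal independent subset of \<open>N\<close> to one of \<open>V\<close> and keep the
  new vectors. It serves twice, with \<open>N\<close> the multiples by variables (graded Nakayama)
  and with \<open>N\<close> a kernel (rank-nullity).\<close>

lemma (in vector_space) relative_basis:
  assumes "N \<subseteq> V" "V \<subseteq> span T" "finite T"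
  obtains G where "finite G" "G \<subseteq> V" "V \<subseteq> span (N \<union> G)"
    "\<And>c x. (\<Sum>x\<in>G. scale (c x) x) \<in> span N \<Longrightarrow> x \<in> G \<Longrightarrow> c x = 0"
    "dim V = dim N + card G"
proof -
  obtain A where A: "A \<subseteq> N" "independent A" "N \<subseteq> span A"
    by (rule maximal_independent_subset)
  obtain C where C: "A \<subseteq> C" "C \<subseteq> V" "independent C" "V \<subseteq> span C"
    using maximal_independent_subset_extend[of A V] A assms(1) by blast
  have fin: "finite C" using independent_span_bound[of T C] assms C by auto
  have NA: "span N = span A" using A span_eq span_superset by blast
  have dim: "dim V = dim N + card (C - A)"
    using basis_card_eq_dim[OF C(2,4,3)] basis_card_eq_dim[OF A(1,3,2)] fin C(1)
    by (metis card_Diff_subset card_mono finite_subset le_add_diff_inverse)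
  show thesis
  proof (rule that[of "C - A"])
    show "V \<subseteq> span (N \<union> (C - A))"
    proof -
      have "C \<subseteq> span (N \<union> (C - A))"
        using A NA span_superset[of N] span_superset[of "N \<union> (C - A)"] by blast
      then show ?thesis using C(4) span_minimal subspace_span by blast
    qed
    fix c x assume s: "(\<Sum>x\<in>C - A. scale (c x) x) \<in> span N" and x: "x \<in> C - A"
    show "c x = 0"
    proof (rule ccontr)
      assume c: "c x \<noteq> 0"
      \<comment> \<open>Solving for the term at \<open>x\<close> puts \<open>x\<close> into the span
        of the other elements of \<open>C\<close>, against the independence of
        \<open>C\<close>.\<close>
      let ?S = "\<Sum>y\<in>C - A - {x}. scale (c y) y"
      have "scale (c x) x = (\<Sum>x\<in>C - A. scale (c x) x) - ?S"
        using fin x by (simp add: sum.remove)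
      moreover have "(\<Sum>x\<in>C - A. scale (c x) x) \<in> span (C - {x})"
        using s x C(1) span_mono[of A "C - {x}"] unfolding NA by auto
      moreover have "?S \<in> span (C - {x})"
        by (intro span_sum span_scale span_base) auto
      ultimately have "scale (c x) x \<in> span (C - {x})"
        by (simp only: span_diff)
      then have "scale (inverse (c x)) (scale (c x) x) \<in> span (C - {x})" by (rule span_scale)
      then have "x \<in> span (C - {x})" using c by simp
      then show False using C(3) x unfolding dependent_def by blast
    qed
  qed (use fin C dim in auto)
qed

text \<open>Restriction of scalars to the constant polynomials: every submodule becomes a vector
  space over the field, and its graded pieces have dimensions.\<close>

definition kscale :: "'k \<Rightarrow> (nat \<Rightarrow>\<^sub>0 ('n, 'k::field) mpoly) \<Rightarrow> (nat \<Rightarrow>\<^sub>0 ('n, 'k) mpoly)" where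
  "kscale c = smult_vec (Poly_Mapping.single 0 c)"

lemma coeff_kscale [simp]: "coeff_vec (kscale c v) b m = c * coeff_vec v b m"
  by (simp add: kscale_def)

lemma vector_space_kscale: "vector_space kscale"
  by unfold_locales (auto intro!: vec_eqI simp: lookup_add algebra_simps)

interpretation kvec: vector_space kscale
  by (rule vector_space_kscale)

lemma kvec_subspace: "vec.subspace M \<Longrightarrow> kvec.subspace M"
  by (simp add: vec.subspace_def kvec.subspace_def kscale_def)

lemma finite_monoms_of_deg: "finite {m :: 'n::finite \<Rightarrow>\<^sub>0 nat. monom_deg m = e}"
proof -
  have "Poly_Mapping.lookup ` {m :: 'n \<Rightarrow>\<^sub>0 nat. monom_deg m = e} \<subseteq> (UNIV \<rightarrow>\<^sub>E {..e})"
  proof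
    fix f assume "f \<in> Poly_Mapping.lookup ` {m :: 'n \<Rightarrow>\<^sub>0 nat. monom_deg m = e}"
    then obtain m where m: "f = Poly_Mapping.lookup m" "(\<Sum>v\<in>UNIV. Poly_Mapping.lookup m v) = e"
      by (auto simp: monom_deg_def)
    have "f x \<le> e" for x
      using member_le_sum[of x UNIV f] m by auto
    then show "f \<in> (UNIV \<rightarrow>\<^sub>E {..e})" by auto
  qed
  then have "finite (Poly_Mapping.lookup ` {m :: 'n \<Rightarrow>\<^sub>0 nat. monom_deg m = e})"
    by (rule finite_subset) (simp add: finite_PiE)
  then show ?thesis by (rule finite_imageD) (auto simp: inj_on_def intro: poly_mapping_eqI)
qed

text \<open>Graded pieces of free modules and of a square-free monomial ideal both have this form,
  so one dimension formula covers both.\<close>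

definition supported :: "(nat \<times> ('n \<Rightarrow>\<^sub>0 nat)) set \<Rightarrow> (nat \<Rightarrow>\<^sub>0 ('n, 'k::field) mpoly) set" where
  "supported T = {v. \<forall>b m. coeff_vec v b m \<noteq> 0 \<longrightarrow> (b, m) \<in> T}"

lemma coeff_monom_vec: "coeff_vec (monom_vec b m c) b' m' = (if b' = b \<and> m' = m then c else 0)"
  by (simp add: lookup_single when_def)

lemma supported_basis:
  fixes T :: "(nat \<times> ('n \<Rightarrow>\<^sub>0 nat)) set"
  assumes "finite T"
  defines "X \<equiv> (\<lambda>(b, m). monom_vec b m (1::'k::field)) ` T"
  shows "kvec.independent X" "kvec.span X = supported T" "card X = card T"
proof -
  have inj: "inj_on (\<lambda>(b, m). monom_vec b m (1::'k)) T"
  proof (rule inj_onI, clarify)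
    fix b m b' m' assume "monom_vec b m (1::'k) = monom_vec b' m' 1"
    then have "coeff_vec (monom_vec b m (1::'k)) b m = coeff_vec (monom_vec b' m' (1::'k)) b m" by simp
    then show "b = b' \<and> m = m'" by (simp add: coeff_monom_vec split: if_splits)
  qed
  then show "card X = card T" unfolding X_def by (rule card_image)
  have fX: "finite X" using assms by simp
  have coeff: "coeff_vec (\<Sum>x\<in>X. kscale (f x) x) b m = (if (b, m) \<in> T then f (monom_vec b m 1) else 0)" for f b m
  proof -
    have "coeff_vec (\<Sum>x\<in>X. kscale (f x) x) b m
      = (\<Sum>t\<in>T. if t = (b, m) then f (monom_vec b m 1) else 0)"
      unfolding X_def sum.reindex[OF inj] lookup_sum
      by (rule sum.cong[OF refl]) (auto simp: coeff_monom_vec split: if_splits)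
    then show ?thesis using assms(1) by simp
  qed
  show "kvec.independent X"
  proof (rule kvec.independent_if_scalars_zero[OF fX])
    fix f x assume z: "(\<Sum>x\<in>X. kscale (f x) x) = 0" and "x \<in> X"
    then obtain b m where "(b, m) \<in> T" "x = monom_vec b m 1" by (auto simp: X_def)
    then show "f x = 0" using coeff[of f b m] z by simp
  qed
  show "kvec.span X = supported T"
  proof
    have "kvec.subspace (supported T :: (nat \<Rightarrow>\<^sub>0 ('n, 'k) mpoly) set)"
      unfolding kvec.subspace_def supported_def
      by (auto simp: lookup_add) (metis add_0)
    moreover have "X \<subseteq> supported T"
      by (auto simp: X_def supported_def coeff_monom_vec split: if_splits)
    ultimately show "kvec.span X \<subseteq> supported T" by (rule kvec.span_minimal[rotated])
    show "supported T \<subseteq> kvec.span X"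
    proof
      fix v :: "nat \<Rightarrow>\<^sub>0 ('n, 'k) mpoly" assume v: "v \<in> supported T"
      \<comment> \<open>Coefficients must be indexed by the vectors in \<open>X\<close>, not by
        \<open>T\<close>. By injectivity at most one summand survives, so this sum looks up the
        index belonging to \<open>x\<close>.\<close>
      let ?f = "\<lambda>x. (\<Sum>t\<in>T. if x = monom_vec (fst t) (snd t) (1::'k) then coeff_vec v (fst t) (snd t) else 0)"
      have f: "?f (monom_vec b m 1) = coeff_vec v b m" if "(b, m) \<in> T" for b m
      proof -
        have "?f (monom_vec b m 1) = (\<Sum>t\<in>T. if t = (b, m) then coeff_vec v b m else 0)"
        proof (rule sum.cong[OF refl])
          fix t assume "t \<in> T"
          then show "(if monom_vec b m 1 = monom_vec (fst t) (snd t) (1::'k) then coeff_vec v (fst t) (snd t) else 0)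
            = (if t = (b, m) then coeff_vec v b m else 0)"
            using inj that by (cases t) (auto simp: inj_on_def)
        qed
        then show ?thesis using that assms(1) by simp
      qed
      have "v = (\<Sum>x\<in>X. kscale (?f x) x)"
      proof (rule vec_eqI)
        fix b m
        show "coeff_vec v b m = coeff_vec (\<Sum>x\<in>X. kscale (?f x) x) b m"
          unfolding coeff using f v by (auto simp: supported_def)
      qed
      then show "v \<in> kvec.span X"
        by (metis (no_types, lifting) kvec.span_base kvec.span_scale kvec.span_sum)
    qed
  qed
qed

definition graded_piece :: "(nat \<Rightarrow> nat) \<Rightarrow> nat \<Rightarrow> (nat \<Rightarrow>\<^sub>0 ('n::finite, 'k::field) mpoly) set \<Rightarrow> (nat \<Rightarrow>\<^sub>0 ('n, 'k) mpoly) set" where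
  "graded_piece d j M = {v \<in> M. homogeneous_vec d j v}"

text \<open>Finiteness degree by degree is what a cover built degree by degree supplies and what
  dimension counts consume.\<close>

definition locally_finite :: "nat set \<Rightarrow> (nat \<Rightarrow> nat) \<Rightarrow> bool" where
  "locally_finite B d \<longleftrightarrow> (\<forall>j. finite {b \<in> B. d b = j})"

text \<open>Indexes the field basis of the degree \<open>j\<close> piece of a free module. The guard
  \<open>d b \<le> j\<close> stops the truncated difference from pairing a generator of degree above
  \<open>j\<close> with the monomial 1.\<close>

definition monom_basis :: "nat set \<Rightarrow> (nat \<Rightarrow> nat) \<Rightarrow> nat \<Rightarrow> (nat \<times> ('n::finite \<Rightarrow>\<^sub>0 nat)) set" where
  "monom_basis B d j = (SIGMA b:{b \<in> B. d b \<le> j}. {m. monom_deg m = j - d b})"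

lemma locally_finite_le: "locally_finite B d \<Longrightarrow> finite {b \<in> B. d b \<le> j}"
proof -
  assume "locally_finite B d"
  moreover have "{b \<in> B. d b \<le> j} = (\<Union>i\<in>{..j}. {b \<in> B. d b = i})" by auto
  ultimately show ?thesis by (simp add: locally_finite_def)
qed

lemma finite_monom_basis: "locally_finite B d \<Longrightarrow> finite (monom_basis B d j)"
  unfolding monom_basis_def by (intro finite_SigmaI locally_finite_le finite_monoms_of_deg)

lemma mem_monom_basis_iff: "(b, m) \<in> monom_basis B d j \<longleftrightarrow> b \<in> B \<and> monom_deg m + d b = j"
  by (auto simp: monom_basis_def)

lemma mem_free_module_coeff_iff: "v \<in> free_module B \<longleftrightarrow> (\<forall>b m. coeff_vec v b m \<noteq> 0 \<longrightarrow> b \<in> B)"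
proof
  assume v: "\<forall>b m. coeff_vec v b m \<noteq> 0 \<longrightarrow> b \<in> B"
  show "v \<in> free_module B" unfolding mem_free_module_iff
    by (intro allI impI poly_mapping_eqI) (use v in auto)
qed (auto simp: mem_free_module_iff)

lemma graded_piece_free_module:
  "graded_piece d j (free_module B) =
    (supported (monom_basis B d j) :: (nat \<Rightarrow>\<^sub>0 ('n::finite, 'k::field) mpoly) set)"
  unfolding graded_piece_def supported_def homogeneous_vec_iff mem_free_module_coeff_iff mem_monom_basis_iff
  by blast

lemma kvec_subspace_graded_piece:
  "vec.subspace M \<Longrightarrow> kvec.subspace (graded_piece d j M)"
  unfolding kvec.subspace_def graded_piece_def kscale_def
  using homogeneous_vec_smult[OF homogeneous_const]
  by (auto simp: vec.subspace_0 vec.subspace_add vec.subspace_scale homogeneous_vec_add)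

section \<open>Minimal covers of graded submodules\<close>

definition graded_submodule :: "(nat \<Rightarrow> nat) \<Rightarrow> nat set \<Rightarrow> (nat \<Rightarrow>\<^sub>0 ('n::finite, 'k::field) mpoly) set \<Rightarrow> bool" where
  "graded_submodule d B M \<longleftrightarrow>
     vec.subspace M \<and> M \<subseteq> free_module B \<and> (\<forall>j. \<forall>v\<in>M. homog_part d j v \<in> M)"

text \<open>\<open>d\<close> grades the ambient module of \<open>M\<close>, and \<open>d'\<close>
  the free module that maps onto \<open>M\<close>. The last clause says that the kernel lies in the
  graded maximal ideal times that free module; stated for the kernel, it gives the minimality
  condition on the next map.\<close>

definition minimal_cover ::
  "(nat \<Rightarrow> nat) \<Rightarrow> (nat \<Rightarrow>\<^sub>0 ('n::finite, 'k::field) mpoly) set \<Rightarrow> nat set \<Rightarrow> (nat \<Rightarrow> nat)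
    \<Rightarrow> (nat \<Rightarrow> (nat \<Rightarrow>\<^sub>0 ('n, 'k) mpoly)) \<Rightarrow> bool" where
  "minimal_cover d M B' d' g \<longleftrightarrow> locally_finite B' d' \<and>
     (\<forall>b\<in>B'. homogeneous_vec d (d' b) (g b)) \<and>
     mvec_map g ` free_module B' = M \<and>
     (\<forall>v\<in>free_module B'. mvec_map g v = 0 \<longrightarrow> (\<forall>b. coeff_vec v b 0 = 0))"

lemma var_mult_single: "var x * Poly_Mapping.single m c = Poly_Mapping.single (Poly_Mapping.single x 1 + m) c"
  by (simp add: var_def mult_single)

text \<open>For graded \<open>M\<close> this spans, over the field, the degree \<open>j\<close>
  piece of the graded maximal ideal times \<open>M\<close>. It is empty for
  \<open>j = 0\<close>.\<close>

definition var_multiples :: "(nat \<Rightarrow> nat) \<Rightarrow> (nat \<Rightarrow>\<^sub>0 ('n::finite, 'k::field) mpoly) set \<Rightarrow> nat \<Rightarrow> (nat \<Rightarrow>\<^sub>0 ('n, 'k) mpoly) set" where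
  "var_multiples d M j = {smult_vec (var x) v | x v i. Suc i = j \<and> v \<in> graded_piece d i M}"

lemma monom_pos_degE:
  assumes "m \<noteq> 0"
  obtains x m' where "m = Poly_Mapping.single x (1::nat) + m'"
proof -
  from assms obtain x where x: "Poly_Mapping.lookup m x \<noteq> 0" by (metis lookup_zero poly_mapping_eqI)
  have "m = Poly_Mapping.single x 1 + (m - Poly_Mapping.single x 1)"
    using x by (intro poly_mapping_eqI) (auto simp: lookup_add lookup_minus lookup_single when_def)
  then show thesis by (rule that)
qed

text \<open>Each monomial of \<open>p\<close> has positive degree and so splits off a variable. In a
  relation between generators this makes all terms with nonconstant coefficients vanish modulo the
  multiples by variables.\<close>

lemma smult_in_span_var_multiples:
  assumes "vec.subspace M" "u \<in> graded_piece d i M" "homogeneous e p" "e > 0"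
  shows "smult_vec p u \<in> kvec.span (var_multiples d M (e + i))"
proof -
  have eq: "smult_vec p u = (\<Sum>m\<in>Poly_Mapping.keys p. smult_vec (Poly_Mapping.single m (Poly_Mapping.lookup p m)) u)"
    using poly_mapping_sum_monoms[of "Poly_Mapping.keys p" p] by (metis finite_keys order_refl vec.scale_sum_left)
  show ?thesis unfolding eq
  proof (rule kvec.span_sum)
    fix m assume m: "m \<in> Poly_Mapping.keys p"
    let ?c = "Poly_Mapping.lookup p m"
    have deg: "monom_deg m = e" using m assms(3) by (simp add: homogeneous_def)
    then have "m \<noteq> 0" using assms(4) by auto
    then obtain x m' where m': "m = Poly_Mapping.single x (1::nat) + m'" by (rule monom_pos_degE)
    then have e: "e = Suc (monom_deg m')" using deg by (simp add: monom_deg_add)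
    have "smult_vec (Poly_Mapping.single m' ?c) u \<in> graded_piece d (monom_deg m' + i) M"
      using assms(1,2) homogeneous_vec_smult[of "monom_deg m'" "Poly_Mapping.single m' ?c" d i u]
      by (auto simp: graded_piece_def homogeneous_def vec.subspace_scale)
    then have "smult_vec (var x) (smult_vec (Poly_Mapping.single m' ?c) u) \<in> var_multiples d M (e + i)"
      unfolding var_multiples_def using e by (auto simp del: vec.scale_scale)
    then show "smult_vec (Poly_Mapping.single m ?c) u \<in> kvec.span (var_multiples d M (e + i))"
      by (simp add: m' var_mult_single kvec.span_base)
  qed
qed

lemma homogeneous_0_iff: "homogeneous 0 p \<longleftrightarrow> p = Poly_Mapping.single 0 (Poly_Mapping.lookup p 0)"
proof
  assume h: "homogeneous 0 p"
  show "p = Poly_Mapping.single 0 (Poly_Mapping.lookup p 0)"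
  proof (rule poly_mapping_eqI)
    fix m show "Poly_Mapping.lookup p m = Poly_Mapping.lookup (Poly_Mapping.single 0 (Poly_Mapping.lookup p 0)) m"
      using h by (auto simp: homogeneous_def monom_deg_eq_0_iff lookup_single when_def in_keys_iff)
  qed
qed (metis homogeneous_const)

text \<open>Graded Nakayama: homogeneous elements of \<open>M\<close> that form a basis modulo the multiples by
  the variables generate \<open>M\<close>, and their relations have no constant coefficients.\<close>

lemma minimal_cover_exists:
  fixes M :: "(nat \<Rightarrow>\<^sub>0 ('n::finite, 'k::field) mpoly) set"
  assumes lf: "locally_finite B d" and M: "graded_submodule d B M"
  obtains B' d' g where "minimal_cover d M B' d' g"
proof -
  have sub: "vec.subspace M" and MB: "M \<subseteq> free_module B" and part: "\<And>j v. v \<in> M \<Longrightarrow> homog_part d j v \<in> M"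
    using M by (auto simp: graded_submodule_def)
  define N where "N = var_multiples d M"
  have NM: "N j \<subseteq> graded_piece d j M" for j
  proof -
    have "smult_vec (var x) v \<in> graded_piece d (Suc i) M" if "v \<in> graded_piece d i M" for x i v
    proof -
      have "homogeneous 1 (var x :: ('n, 'k) mpoly)" by (simp add: homogeneous_def var_def)
      then show ?thesis
        using that homogeneous_vec_smult[of 1 "var x" d i v] sub by (auto simp: graded_piece_def vec.subspace_scale)
    qed
    then show ?thesis by (auto simp: N_def var_multiples_def)
  qed
  \<comment> \<open>The new generators in degree \<open>j\<close> are a basis of the degree
    \<open>j\<close> piece of \<open>M\<close> modulo \<open>N j\<close>.\<close>
  have "\<exists>G. finite G \<and> G \<subseteq> graded_piece d j M \<and> graded_piece d j M \<subseteq> kvec.span (N j \<union> G) \<and>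
     (\<forall>c. (\<Sum>x\<in>G. kscale (c x) x) \<in> kvec.span (N j) \<longrightarrow> (\<forall>x\<in>G. c x = 0))" for j
  proof -
    let ?T = "(\<lambda>(b, m). monom_vec b m (1::'k)) ` monom_basis B d j :: (nat \<Rightarrow>\<^sub>0 ('n, 'k) mpoly) set"
    have "kvec.span ?T = graded_piece d j (free_module B)"
      unfolding graded_piece_free_module by (rule supported_basis(2)[OF finite_monom_basis[OF lf]])
    then have "graded_piece d j M \<subseteq> kvec.span ?T" using MB by (auto simp: graded_piece_def)
    moreover have "finite ?T" by (intro finite_imageI finite_monom_basis lf)
    ultimately show ?thesis by (rule kvec.relative_basis[OF NM[of j]]) blast
  qed
  then obtain G where G: "\<And>j. finite (G j)" "\<And>j. G j \<subseteq> graded_piece d j M"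
    "\<And>j. graded_piece d j M \<subseteq> kvec.span (N j \<union> G j)"
    "\<And>j c x. (\<Sum>x\<in>G j. kscale (c x) x) \<in> kvec.span (N j) \<Longrightarrow> x \<in> G j \<Longrightarrow> c x = 0"
    by meson
  obtain L where L: "\<And>j. set (L j) = G j" "\<And>j. distinct (L j)"
    using finite_distinct_list[OF G(1)] by metis
  \<comment> \<open>A generator is indexed by the code of the pair (degree, position in the list of
    generators of that degree), so its degree can be read off its index.\<close>
  define d' where "d' b = fst (prod_decode b)" for b
  define B' where "B' = {b. snd (prod_decode b) < length (L (d' b))}"
  define g where "g b = L (d' b) ! snd (prod_decode b)" for b
  have bij: "bij_betw g {b \<in> B'. d' b = j} (G j)" for j
  proof (rule bij_betw_imageI)
    show "inj_on g {b \<in> B'. d' b = j}"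
      unfolding inj_on_def B'_def g_def d'_def using L(2)
      by (metis (mono_tags, lifting) mem_Collect_eq nth_eq_iff_index_eq prod_decode_eq prod_eqI)
    show "g ` {b \<in> B'. d' b = j} = G j"
    proof
      show "g ` {b \<in> B'. d' b = j} \<subseteq> G j" by (auto simp: B'_def g_def simp flip: L(1))
      show "G j \<subseteq> g ` {b \<in> B'. d' b = j}"
      proof
        fix x assume "x \<in> G j"
        then obtain i where i: "i < length (L j)" "x = L j ! i" using L(1) by (metis in_set_conv_nth)
        then have "prod_encode (j, i) \<in> {b \<in> B'. d' b = j}" "g (prod_encode (j, i)) = x"
          by (simp_all add: B'_def d'_def g_def)
        then show "x \<in> g ` {b \<in> B'. d' b = j}" by blast
      qed
    qed
  qed
  have lf': "locally_finite B' d'"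
    unfolding locally_finite_def using bij G(1) bij_betw_finite by blast
  have g: "g b \<in> graded_piece d (d' b) M" if "b \<in> B'" for b
    using bij[of "d' b"] G(2)[of "d' b"] that by (auto simp: bij_betw_def)
  then have gM: "g b \<in> M" and gh: "homogeneous_vec d (d' b) (g b)" if "b \<in> B'" for b
    using that by (auto simp: graded_piece_def)
  let ?Im = "mvec_map g ` free_module B'"
  have subIm: "vec.subspace ?Im" by (rule mvec_map.subspace_image[OF subspace_free_module])
  \<comment> \<open>Induction on the degree is the Nakayama argument: \<open>N j\<close> consists of
    multiples of elements of degree \<open>j - 1\<close>, already in the image, and
    \<open>G j\<close> consists of images of basis vectors.\<close>
  have piece: "graded_piece d j M \<subseteq> ?Im" for j
  proof (induction j rule: less_induct)
    case (less j)
    have "N j \<subseteq> ?Im"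
      using less.IH vec.subspace_scale[OF subIm] by (fastforce simp: N_def var_multiples_def)
    moreover have "G j \<subseteq> ?Im"
    proof
      fix x assume "x \<in> G j"
      then obtain b where b: "b \<in> B'" "x = g b" using bij[of j] by (auto simp: bij_betw_def)
      then have "mvec_map g (Poly_Mapping.single b 1) = x" "Poly_Mapping.single b 1 \<in> free_module B'"
        by (auto simp: linear_ext_single[OF module_smult_vec] free_module_def)
      then show "x \<in> ?Im" by blast
    qed
    ultimately have "kvec.span (N j \<union> G j) \<subseteq> ?Im"
      by (intro kvec.span_minimal kvec_subspace subIm) auto
    then show ?case using G(3) by blast
  qed
  have im: "?Im = M"
  proof
    show "?Im \<subseteq> M" using mvec_map_mem[OF sub] gM by blast
    show "M \<subseteq> ?Im"
    proof
      fix v assume v: "v \<in> M"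
      obtain J where J: "v = (\<Sum>j\<in>J. homog_part d j v)" by (rule sum_homog_parts)
      have "homog_part d j v \<in> ?Im" for j
        using piece[of j] part[OF v] by (auto simp: graded_piece_def homogeneous_vec_homog_part)
      then show "v \<in> ?Im" by (subst J) (intro vec.subspace_sum subIm)
    qed
  qed
  have "coeff_vec v b0 0 = 0" if v: "v \<in> free_module B'" "mvec_map g v = 0" for v b0
  proof (cases "b0 \<in> B'")
    case True
    \<comment> \<open>The component of the relation in the degree of \<open>b0\<close> is again a
      relation, and it keeps the constant coefficient at \<open>b0\<close>.\<close>
    define j where "j = d' b0"
    define w where "w = homog_part d' j v"
    have wh: "homogeneous_vec d' j w" unfolding w_def by (rule homogeneous_vec_homog_part)
    have wB: "w \<in> free_module B'" unfolding w_def by (rule homog_part_free_module[OF v(1)])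
    have w0: "mvec_map g w = 0"
      unfolding w_def using homog_part_mvec_map[of v B' d d' g j, OF v(1) gh] v(2)
      by simp
    \<comment> \<open>In the degree \<open>j\<close> relation \<open>w\<close>, generators of degree
      \<open>j\<close> carry constant coefficients. All others carry coefficients of positive degree
      and land in the span of \<open>N j\<close>, so independence of \<open>G j\<close> modulo
      \<open>N j\<close> kills the constants.\<close>
    define C where "C = {b \<in> B'. d' b = j}"
    have finC: "finite C" using lf' by (simp add: C_def locally_finite_def)
    let ?t = "\<lambda>b. smult_vec (Poly_Mapping.lookup w b) (g b)"
    let ?K = "Poly_Mapping.keys w"
    have "mvec_map g w = (\<Sum>b\<in>?K \<union> C. ?t b)"
      by (rule linear_ext_superset[OF module_smult_vec]) (use finC in auto)
    also have "\<dots> = (\<Sum>b\<in>C. ?t b) + (\<Sum>b\<in>?K - C. ?t b)"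
      using finC sum.union_disjoint[of C "?K - C" ?t] by (simp add: Un_commute)
    also have "(\<Sum>b\<in>C. ?t b) = (\<Sum>b\<in>C. kscale (coeff_vec w b 0) (g b))"
    proof (rule sum.cong[OF refl])
      fix b assume b: "b \<in> C"
      have "homogeneous 0 (Poly_Mapping.lookup w b)"
        using b wh by (fastforce simp: C_def homogeneous_vec_def homogeneous_def)
      then show "?t b = kscale (coeff_vec w b 0) (g b)"
        unfolding kscale_def homogeneous_0_iff by simp
    qed
    also have "\<dots> = (\<Sum>x\<in>G j. kscale (coeff_vec w (the_inv_into C g x) 0) x)"
      using bij[of j] unfolding C_def[symmetric]
      by (subst sum.reindex_bij_betw[symmetric, of g C "G j"])
        (auto intro!: sum.cong simp: the_inv_into_f_f bij_betw_def)
    finally have "(\<Sum>x\<in>G j. kscale (coeff_vec w (the_inv_into C g x) 0) x) = - (\<Sum>b\<in>?K - C. ?t b)"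
      using w0 by (simp add: eq_neg_iff_add_eq_0)
    moreover have "(\<Sum>b\<in>?K - C. ?t b) \<in> kvec.span (N j)"
    proof (rule kvec.span_sum)
      fix b assume b: "b \<in> ?K - C"
      then have bB: "b \<in> B'" using wB by (auto simp: free_module_def)
      have nz: "Poly_Mapping.lookup w b \<noteq> 0" using b by (simp add: in_keys_iff)
      note h = homogeneous_coeff_of_homogeneous_vec[OF wh nz]
      have "d' b \<noteq> j" using b bB by (simp add: C_def)
      then show "?t b \<in> kvec.span (N j)"
        using smult_in_span_var_multiples[OF sub g[OF bB] h(2)] h(1) by (simp add: N_def)
    qed
    ultimately have "(\<Sum>x\<in>G j. kscale (coeff_vec w (the_inv_into C g x) 0) x) \<in> kvec.span (N j)"
      by (simp add: kvec.span_neg)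
    moreover have b0: "b0 \<in> C" using True by (simp add: C_def j_def)
    then have "g b0 \<in> G j" using bij[of j] by (auto simp: C_def bij_betw_def)
    ultimately have "coeff_vec w (the_inv_into C g (g b0)) 0 = 0" by (rule G(4))
    then have "coeff_vec w b0 0 = 0"
      using bij[of j] b0 by (simp add: C_def[symmetric] bij_betw_def the_inv_into_f_f)
    then show ?thesis by (simp add: w_def j_def)
  qed (use v in \<open>simp add: mem_free_module_iff\<close>)
  then have "minimal_cover d M B' d' g"
    unfolding minimal_cover_def using lf' gh im by blast
  then show thesis by (rule that)
qed

section \<open>Square-free monomial ideals\<close>

lemma monom_add_eq_0_iff: "(a :: 'n \<Rightarrow>\<^sub>0 nat) + b = 0 \<longleftrightarrow> a = 0 \<and> b = 0"
proof
  assume "a + b = 0"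
  then have "Poly_Mapping.lookup a x + Poly_Mapping.lookup b x = 0" for x
    by (metis lookup_add lookup_zero)
  then show "a = 0 \<and> b = 0" by (auto intro: poly_mapping_eqI)
qed simp

text \<open>A product of monomials is 1 only if both factors are, so a vanishing constant term
  survives multiplication; conversely every nonconstant monomial has a variable as a factor. This
  translates between minimality of resolutions and of covers.\<close>

lemma mem_graded_maximal_ideal_iff:
  fixes p :: "('n::finite, 'k::field) mpoly"
  shows "p \<in> graded_maximal_ideal \<longleftrightarrow> Poly_Mapping.lookup p 0 = 0"
proof -
  interpret module "(*) :: ('n, 'k) mpoly \<Rightarrow> _" by (rule module_mult)
  have "subspace {p :: ('n, 'k) mpoly. 0 \<notin> Poly_Mapping.keys p}"
    unfolding subspace_def
  proof (intro conjI ballI allI)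
    fix q p :: "('n, 'k) mpoly" assume "p \<in> {p. 0 \<notin> Poly_Mapping.keys p}"
    moreover have "0 \<in> Poly_Mapping.keys p" if "0 \<in> Poly_Mapping.keys (q * p)"
    proof -
      obtain a b where "0 = a + b" "b \<in> Poly_Mapping.keys p" using keys_mult \<open>0 \<in> Poly_Mapping.keys (q * p)\<close> by blast
      then show ?thesis using monom_add_eq_0_iff[of a b] by simp
    qed
    ultimately show "q * p \<in> {p. 0 \<notin> Poly_Mapping.keys p}" by blast
  qed (auto simp: in_keys_iff lookup_add)
  moreover have "range var \<subseteq> {p :: ('n, 'k) mpoly. 0 \<notin> Poly_Mapping.keys p}"
  proof -
    have "Poly_Mapping.single x (1::nat) \<noteq> 0" for x :: 'n
      by (metis lookup_single_eq lookup_zero zero_neq_one)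
    then show ?thesis by (auto simp: var_def)
  qed
  ultimately have "span (range var) \<subseteq> {p :: ('n, 'k) mpoly. 0 \<notin> Poly_Mapping.keys p}"
    by (rule span_minimal[rotated])
  moreover have "p \<in> span (range var)" if "0 \<notin> Poly_Mapping.keys p"
  proof -
    have "p = (\<Sum>m\<in>Poly_Mapping.keys p. Poly_Mapping.single m (Poly_Mapping.lookup p m))"
      by (rule poly_mapping_sum_monoms) auto
    also have "\<dots> \<in> span (range var)"
    proof (rule span_sum)
      fix m assume m: "m \<in> Poly_Mapping.keys p"
      then have "m \<noteq> 0" using that by auto
      then obtain x m' where m': "m = Poly_Mapping.single x (1::nat) + m'" by (rule monom_pos_degE)
      have "Poly_Mapping.single m' (Poly_Mapping.lookup p m) * var x \<in> span (range var)"
        by (intro span_scale span_base) simp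
      then show "Poly_Mapping.single m (Poly_Mapping.lookup p m) \<in> span (range var)"
        by (subst m') (simp add: mult.commute[of _ "var x"] var_mult_single)
    qed
    finally show ?thesis .
  qed
  ultimately show ?thesis unfolding graded_maximal_ideal_def by (auto simp: in_keys_iff)
qed

definition indicator_monom :: "'n::finite set \<Rightarrow> ('n \<Rightarrow>\<^sub>0 nat)" where
  "indicator_monom F = (\<Sum>v\<in>F. Poly_Mapping.single v 1)"

lemma lookup_indicator_monom: "Poly_Mapping.lookup (indicator_monom F) x = (if x \<in> F then 1 else 0)"
  by (simp add: indicator_monom_def lookup_sum lookup_single when_def)

lemma keys_indicator_monom [simp]: "Poly_Mapping.keys (indicator_monom F) = F"
  by (auto simp: in_keys_iff lookup_indicator_monom split: if_splits)

lemma squarefree_monom_eq: "squarefree_monom F = Poly_Mapping.single (indicator_monom F) 1"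
proof -
  have "finite F" by simp
  then show ?thesis unfolding squarefree_monom_def indicator_monom_def
    by (induction F) (simp_all add: var_mult_single)
qed

lemma keys_monom_add: "Poly_Mapping.keys ((a :: 'n \<Rightarrow>\<^sub>0 nat) + b) = Poly_Mapping.keys a \<union> Poly_Mapping.keys b"
  by (auto simp: in_keys_iff lookup_add)

text \<open>Membership is decided monomial by monomial, and divisibility by a square-free monomial
  depends only on the support.\<close>

lemma span_squarefree_monoms:
  fixes \<F> :: "'n::finite set set"
  shows "module.span (*) (squarefree_monom ` \<F>) =
    {p :: ('n, 'k::field) mpoly. \<forall>m\<in>Poly_Mapping.keys p. \<exists>F\<in>\<F>. F \<subseteq> Poly_Mapping.keys m}" (is "_ = ?S")
proof -
  interpret module "(*) :: ('n, 'k) mpoly \<Rightarrow> _" by (rule module_mult)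
  have "subspace ?S"
    unfolding subspace_def
  proof (intro conjI ballI allI)
    fix p q assume "p \<in> ?S" "q \<in> ?S"
    then show "p + q \<in> ?S" using Poly_Mapping.keys_add[of p q] by blast
  next
    fix q p assume p: "p \<in> ?S"
    show "q * p \<in> ?S"
    proof (intro CollectI ballI)
      fix m assume "m \<in> Poly_Mapping.keys (q * p)"
      then obtain a b where "m = a + b" "b \<in> Poly_Mapping.keys p" using keys_mult by blast
      moreover from this p obtain F where "F \<in> \<F>" "F \<subseteq> Poly_Mapping.keys b" by blast
      ultimately show "\<exists>F\<in>\<F>. F \<subseteq> Poly_Mapping.keys m" by (auto simp: keys_monom_add)
    qed
  qed simp
  moreover have "squarefree_monom ` \<F> \<subseteq> ?S" by (auto simp: squarefree_monom_eq)
  ultimately have "span (squarefree_monom ` \<F>) \<subseteq> ?S" by (rule span_minimal[rotated])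
  moreover have "p \<in> span (squarefree_monom ` \<F>)" if "p \<in> ?S" for p
  proof -
    have "p = (\<Sum>m\<in>Poly_Mapping.keys p. Poly_Mapping.single m (Poly_Mapping.lookup p m))"
      by (rule poly_mapping_sum_monoms) auto
    also have "\<dots> \<in> span (squarefree_monom ` \<F>)"
    proof (rule span_sum)
      fix m assume m: "m \<in> Poly_Mapping.keys p"
      then obtain F where F: "F \<in> \<F>" "F \<subseteq> Poly_Mapping.keys m" using \<open>p \<in> ?S\<close> by blast
      \<comment> \<open>Truncated subtraction is exact here because every exponent of
        \<open>m\<close> on \<open>F\<close> is at least 1.\<close>
      have m': "m = (m - indicator_monom F) + indicator_monom F"
      proof (rule poly_mapping_eqI)
        fix x
        have "x \<in> F \<Longrightarrow> Poly_Mapping.lookup m x \<ge> 1" using F(2) by (auto simp: in_keys_iff Suc_le_eq)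
        then show "Poly_Mapping.lookup m x = Poly_Mapping.lookup ((m - indicator_monom F) + indicator_monom F) x"
          by (auto simp: lookup_add lookup_minus lookup_indicator_monom)
      qed
      have "Poly_Mapping.single (m - indicator_monom F) (Poly_Mapping.lookup p m) * squarefree_monom F
          \<in> span (squarefree_monom ` \<F>)"
        using F(1) by (intro span_scale span_base) simp
      then show "Poly_Mapping.single m (Poly_Mapping.lookup p m) \<in> span (squarefree_monom ` \<F>)"
        unfolding squarefree_monom_eq mult_single m'[symmetric] by simp
    qed
    finally show ?thesis .
  qed
  ultimately show ?thesis by blast
qed

text \<open>The support of a monomial contains a generating set exactly when the square-free
  monomial on that support lies in \<open>I\<close>, that is, when the support is not a face. This
  links the Hilbert function of \<open>I\<close> to the complex.\<close>

lemma squarefree_monomial_ideal_eq: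
  assumes "squarefree_monomial_ideal I"
  shows "I = {p. \<forall>m\<in>Poly_Mapping.keys p. Poly_Mapping.keys m \<notin> associated_complex I}"
proof -
  from assms obtain \<F> where "I = module.span (*) (squarefree_monom ` \<F>)"
    by (auto simp: squarefree_monomial_ideal_def)
  then have I: "I = {p. \<forall>m\<in>Poly_Mapping.keys p. \<exists>F\<in>\<F>. F \<subseteq> Poly_Mapping.keys m}"
    by (simp only: span_squarefree_monoms)
  have "associated_complex I = {G. \<not> (\<exists>F\<in>\<F>. F \<subseteq> G)}"
    unfolding associated_complex_def by (subst I) (simp add: squarefree_monom_eq)
  then show ?thesis using I by simp
qed

lemma squarefree_monomial_ideal_mult:
  fixes I :: "('n::finite, 'k::field) mpoly set"
  assumes "squarefree_monomial_ideal I" "p \<in> I"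
  shows "q * p \<in> I"
proof -
  interpret module "(*) :: ('n, 'k) mpoly \<Rightarrow> _" by (rule module_mult)
  show ?thesis using assms by (auto simp: squarefree_monomial_ideal_def span_scale)
qed

text \<open>The image of \<open>I\<close> under \<open>Poly_Mapping.single 0\<close> is
  \<open>I\<close> inside the rank one free module on the basis index 0. The characterization by
  coefficients shows that it is graded and counts its monomials.\<close>

lemma mem_embedded_ideal_iff:
  assumes "squarefree_monomial_ideal I"
  shows "v \<in> Poly_Mapping.single 0 ` I \<longleftrightarrow>
    (\<forall>b m. coeff_vec v b m \<noteq> 0 \<longrightarrow> b = 0 \<and> Poly_Mapping.keys m \<notin> associated_complex I)"
proof -
  have I: "p \<in> I \<longleftrightarrow> (\<forall>m. Poly_Mapping.lookup p m \<noteq> 0 \<longrightarrow> Poly_Mapping.keys m \<notin> associated_complex I)" for p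
    by (subst squarefree_monomial_ideal_eq[OF assms]) (simp add: in_keys_iff Ball_def)
  show ?thesis
  proof
    assume "v \<in> Poly_Mapping.single 0 ` I"
    then show "\<forall>b m. coeff_vec v b m \<noteq> 0 \<longrightarrow> b = 0 \<and> Poly_Mapping.keys m \<notin> associated_complex I"
      using I by (auto simp: lookup_single when_def split: if_splits)
  next
    assume r: "\<forall>b m. coeff_vec v b m \<noteq> 0 \<longrightarrow> b = 0 \<and> Poly_Mapping.keys m \<notin> associated_complex I"
    have "v = Poly_Mapping.single 0 (Poly_Mapping.lookup v 0)"
      by (rule vec_eqI) (use r in \<open>auto simp: lookup_single when_def\<close>)
    moreover have "Poly_Mapping.lookup v 0 \<in> I" using r I by blast
    ultimately show "v \<in> Poly_Mapping.single 0 ` I" by blast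
  qed
qed

lemma graded_submodule_embedded_ideal:
  fixes I :: "('n::finite, 'k::field) mpoly set"
  assumes "squarefree_monomial_ideal I"
  shows "graded_submodule (\<lambda>_. 0) {0} (Poly_Mapping.single 0 ` I)"
  unfolding graded_submodule_def
proof (intro conjI allI ballI)
  show "vec.subspace (Poly_Mapping.single 0 ` I)"
    unfolding vec.subspace_def
  proof (intro conjI ballI allI)
    fix u v :: "nat \<Rightarrow>\<^sub>0 ('n, 'k) mpoly"
    assume "u \<in> Poly_Mapping.single 0 ` I" "v \<in> Poly_Mapping.single 0 ` I"
    then show "u + v \<in> Poly_Mapping.single 0 ` I"
      unfolding mem_embedded_ideal_iff[OF assms] lookup_add by (metis add_0)
  next
    fix q and v :: "nat \<Rightarrow>\<^sub>0 ('n, 'k) mpoly"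
    assume "v \<in> Poly_Mapping.single 0 ` I"
    then show "smult_vec q v \<in> Poly_Mapping.single 0 ` I"
      using squarefree_monomial_ideal_mult[OF assms] by auto
  qed (simp add: mem_embedded_ideal_iff[OF assms])
  fix j and v :: "nat \<Rightarrow>\<^sub>0 ('n, 'k) mpoly"
  assume "v \<in> Poly_Mapping.single 0 ` I"
  then show "homog_part (\<lambda>_. 0) j v \<in> Poly_Mapping.single 0 ` I"
    by (simp add: mem_embedded_ideal_iff[OF assms])
qed (auto simp: mem_free_module_iff lookup_single when_def)

section \<open>Existence of minimal graded free resolutions\<close>

abbreviation relations :: "nat set \<Rightarrow> (nat \<Rightarrow> (nat \<Rightarrow>\<^sub>0 ('n, 'k::field) mpoly)) \<Rightarrow> (nat \<Rightarrow>\<^sub>0 ('n, 'k) mpoly) set" where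
  "relations B g \<equiv> {v \<in> free_module B. mvec_map g v = 0}"

lemma graded_submodule_relations:
  assumes "\<And>b. b \<in> B \<Longrightarrow> homogeneous_vec d (d' b) (g b)"
  shows "graded_submodule d' B (relations B g)"
proof -
  have "vec.subspace (relations B g)"
    using subspace_free_module[of B] by (auto simp: vec.subspace_def linear_ext_add linear_ext_smult module_smult_vec)
  moreover have "homog_part d' j v \<in> relations B g" if "v \<in> relations B g" for j v
    using that homog_part_mvec_map[of v B d d' g j, OF _ assms] homog_part_free_module[of v B] by simp
  ultimately show ?thesis by (auto simp: graded_submodule_def)
qed

lemma minimal_cover_mem: "minimal_cover d M B' d' g \<Longrightarrow> b \<in> B' \<Longrightarrow> g b \<in> M"
proof -
  assume "minimal_cover d M B' d' g" "b \<in> B'"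
  then have "mvec_map g (Poly_Mapping.single b 1) \<in> M"
    by (auto simp: minimal_cover_def mem_free_module_iff lookup_single when_def)
  then show "g b \<in> M" by (simp add: linear_ext_single[OF module_smult_vec])
qed

lemma linear_ext_lookup: "linear_ext (*) (\<lambda>b. Poly_Mapping.lookup (g b) i) v = Poly_Mapping.lookup (mvec_map g v) i"
  by (simp add: linear_ext_def lookup_sum)

lemma minimal_covers_exist:
  assumes "locally_finite B d" "graded_submodule d B M"
  obtains B' d' g where "minimal_cover d M (B' 0) (d' 0) (g 0)"
    "\<And>i. minimal_cover (d' i) (relations (B' i) (g i)) (B' (Suc i)) (d' (Suc i)) (g (Suc i))"
proof -
  \<comment> \<open>The state is one cover; the invariant says that its relations can be covered in
    turn. The clause for \<open>n = 0\<close> ties the start of the chosen sequence to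
    \<open>M\<close>.\<close>
  let ?P = "\<lambda>(n::nat) (B', d', g). locally_finite B' d' \<and> graded_submodule d' B' (relations B' g) \<and>
     (n = 0 \<longrightarrow> minimal_cover d M B' d' g)"
  let ?Q = "\<lambda>(n::nat) (B', d', g) (B'', d'', g''). minimal_cover d' (relations B' g) B'' d'' g''"
  have rel: "locally_finite B' d' \<and> graded_submodule d' B' (relations B' g)"
    if "minimal_cover d M B' d' g" for d M B' d' g
    using that graded_submodule_relations[of B' d d' g] by (auto simp: minimal_cover_def)
  have "\<exists>f. \<forall>n. ?P n (f n) \<and> ?Q n (f n) (f (Suc n))"
  proof (rule dependent_nat_choice)
    obtain B' d' g where "minimal_cover d M B' d' g" by (rule minimal_cover_exists[OF assms])
    then have "?P 0 (B', d', g)" using rel by simp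
    then show "\<exists>x. ?P 0 x" by blast
  next
    fix x n assume x: "?P n x"
    obtain B' d' g where [simp]: "x = (B', d', g)" by (metis prod_cases3)
    obtain B'' d'' g'' where "minimal_cover d' (relations B' g) B'' d'' g''"
      using x by (auto intro: minimal_cover_exists)
    then have "?P (Suc n) (B'', d'', g'') \<and> ?Q n x (B'', d'', g'')" using rel by simp
    then show "\<exists>y. ?P (Suc n) y \<and> ?Q n x y" by blast
  qed
  then obtain f where f: "\<forall>n. ?P n (f n) \<and> ?Q n (f n) (f (Suc n))" by (rule exE)
  show thesis
  proof (rule that[of "\<lambda>i. fst (f i)" "\<lambda>i. fst (snd (f i))" "\<lambda>i. snd (snd (f i))"])
    show "minimal_cover d M (fst (f 0)) (fst (snd (f 0))) (snd (snd (f 0)))"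
      using spec[OF f, of 0] by (simp add: case_prod_beta)
    show "minimal_cover (fst (snd (f i))) (relations (fst (f i)) (snd (snd (f i))))
        (fst (f (Suc i))) (fst (snd (f (Suc i)))) (snd (snd (f (Suc i))))" for i
      using spec[OF f, of i] by (simp add: case_prod_beta)
  qed
qed

text \<open>\<open>betti\<close> refers to a resolution picked by \<open>SOME\<close>; existence is
  what guarantees that the pick is a minimal resolution.\<close>

theorem minimal_graded_free_resolution_exists:
  fixes I :: "('n::finite, 'k::field) mpoly set"
  assumes "squarefree_monomial_ideal I"
  obtains F where "minimal_graded_free_resolution F I"
proof -
  obtain B d g where c0: "minimal_cover (\<lambda>_. 0) (Poly_Mapping.single 0 ` I) (B 0) (d 0) (g 0)"
    and c: "\<And>i. minimal_cover (d i) (relations (B i) (g i)) (B (Suc i)) (d (Suc i)) (g (Suc i))"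
    using minimal_covers_exist[OF _ graded_submodule_embedded_ideal[OF assms]]
    by (auto simp: locally_finite_def)
  define F :: "('n, 'k) free_seq" where
    "F = \<lparr>gens = B, shift = d, aug = (\<lambda>b. Poly_Mapping.lookup (g 0 b) 0), bdry = (\<lambda>i. g (Suc i))\<rparr>"
  have gens: "gens F = B" by (simp add: F_def)
  have cover: "\<exists>d' M. minimal_cover d' M (B i) (d i) (g i)" for i
    by (cases i) (use c0 c in blast)+
  have aug: "aug_map F v = Poly_Mapping.lookup (mvec_map (g 0) v) 0" for v
    by (simp add: aug_map_def F_def linear_ext_lookup)
  have bdry: "bdry_map F i = mvec_map (g (Suc i))" for i
    by (simp add: bdry_map_def F_def)
  have img0: "mvec_map (g 0) ` free_module (B 0) = Poly_Mapping.single 0 ` I"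
    using c0 by (simp add: minimal_cover_def)
  have img: "mvec_map (g (Suc i)) ` free_module (B (Suc i)) = relations (B i) (g i)" for i
    using c[of i] by (simp add: minimal_cover_def)
  \<comment> \<open>The image lies in the rank one module, so its coordinate at index 0 loses no
    information.\<close>
  have ker0: "mvec_map (g 0) v = 0 \<longleftrightarrow> aug_map F v = 0" if "v \<in> free_module (B 0)" for v
  proof -
    have "mvec_map (g 0) v \<in> Poly_Mapping.single 0 ` I" using img0 that by blast
    then show ?thesis unfolding aug by auto
  qed
  have "graded_free_resolution F I"
    unfolding graded_free_resolution_def term_mod_def bdry
  proof (intro conjI allI ballI)
    show "finite {b \<in> gens F i. shift F i b = j}" for i j
      using cover[of i] by (auto simp: minimal_cover_def locally_finite_def F_def)
    show "homogeneous (shift F 0 b) (aug F b)" if "b \<in> gens F 0" for b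
      using c0 that by (auto simp: minimal_cover_def F_def homogeneous_vec_def homogeneous_def)
    show "bdry F i b \<in> free_module (gens F i)" if "b \<in> gens F (Suc i)" for i b
      using minimal_cover_mem[OF c] that by (simp add: F_def)
    show "homogeneous_vec (shift F i) (shift F (Suc i) b) (bdry F i b)" if "b \<in> gens F (Suc i)" for i b
      using c[of i] that by (simp add: F_def minimal_cover_def)
    have "aug_map F ` free_module (gens F 0) = (\<lambda>v. Poly_Mapping.lookup v 0) ` mvec_map (g 0) ` free_module (B 0)"
      by (simp add: image_image aug gens)
    then show "aug_map F ` free_module (gens F 0) = I"
      unfolding img0 by (simp add: image_image)
    show "{v \<in> free_module (gens F 0). aug_map F v = 0} = mvec_map (g (Suc 0)) ` free_module (gens F 1)"
      using img[of 0] ker0 by (auto simp: gens)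
    show "{v \<in> free_module (gens F (Suc i)). mvec_map (g (Suc i)) v = 0}
      = mvec_map (g (Suc (Suc i))) ` free_module (gens F (Suc (Suc i)))" for i
      using img[of "Suc i"] by (simp add: F_def)
  qed
  moreover have "Poly_Mapping.lookup v b \<in> graded_maximal_ideal"
    if "v \<in> bdry_map F i ` term_mod F (Suc i)" for v i b
  proof -
    have "v \<in> relations (B i) (g i)" using that img[of i] by (simp add: bdry term_mod_def gens)
    then show ?thesis using cover[of i] by (auto simp: minimal_cover_def mem_graded_maximal_ideal_iff)
  qed
  ultimately have "minimal_graded_free_resolution F I"
    unfolding minimal_graded_free_resolution_def by blast
  then show thesis by (rule that)
qed

section \<open>The Hilbert function of a resolution\<close>

text \<open>Only \<open>S\<close> is finite-dimensional, not the ambient space. A basis of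
  \<open>S\<close> modulo the kernel is mapped injectively onto a basis of the image.\<close>

lemma (in Vector_Spaces.linear) rank_nullity:
  assumes S: "vs1.subspace S" "S \<subseteq> vs1.span T" "finite T"
  shows "vs1.dim S = vs1.dim {x \<in> S. f x = 0} + vs2.dim (f ` S)"
proof -
  let ?K = "{x \<in> S. f x = 0}"
  have sub: "vs1.subspace ?K" using S(1) by (auto simp: vs1.subspace_def add scale)
  then have spK: "vs1.span ?K = ?K" by (rule vs1.span_eq_iff[THEN iffD2])
  obtain G where G: "finite G" "G \<subseteq> S" "S \<subseteq> vs1.span (?K \<union> G)"
    "\<And>c x. (\<Sum>x\<in>G. s1 (c x) x) \<in> vs1.span ?K \<Longrightarrow> x \<in> G \<Longrightarrow> c x = 0"
    and dim: "vs1.dim S = vs1.dim ?K + card G"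
    by (rule vs1.relative_basis[of ?K S T]) (use S in auto)
  have comb: "c x = 0" if "f (\<Sum>x\<in>G. s1 (c x) x) = 0" "x \<in> G" for c x
  proof (rule G(4))
    have "(\<Sum>x\<in>G. s1 (c x) x) \<in> S"
      using G(2) S(1) by (intro vs1.subspace_sum vs1.subspace_scale) auto
    then show "(\<Sum>x\<in>G. s1 (c x) x) \<in> vs1.span ?K" unfolding spK using that by simp
  qed (fact that(2))
  have inj: "inj_on f G"
  proof (rule inj_onI, rule ccontr)
    fix x y assume xy: "x \<in> G" "y \<in> G" "f x = f y" "x \<noteq> y"
    \<comment> \<open>If two elements of \<open>G\<close> had the same image, \<open>x - y\<close>
      would be a nontrivial combination of \<open>G\<close> in the kernel.\<close>
    define c where "c z = (if z = x then 1 else if z = y then - 1 else 0 :: 'a)" for z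
    have "(\<Sum>z\<in>G. s1 (c z) z) = (\<Sum>z\<in>G. (if z = x then x else 0) - (if z = y then y else 0))"
      using xy(4) by (intro sum.cong refl) (auto simp: c_def)
    also have "\<dots> = x - y" using G(1) xy by (simp add: sum_subtractf)
    finally have "c x = 0" using comb[of c x] xy by (simp add: diff)
    then show False by (simp add: c_def)
  qed
  have "vs2.independent (f ` G)"
  proof (rule vs2.independent_if_scalars_zero)
    show "finite (f ` G)" using G(1) by simp
    fix u y assume z: "(\<Sum>y\<in>f ` G. s2 (u y) y) = 0" and "y \<in> f ` G"
    then obtain x where x: "x \<in> G" "y = f x" by blast
    have "f (\<Sum>x\<in>G. s1 (u (f x)) x) = 0"
      using z by (simp add: sum.reindex[OF inj] sum scale)
    then show "u y = 0" using comb[of "\<lambda>x. u (f x)" x] x by simp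
  qed
  moreover have "f ` S \<subseteq> vs2.span (f ` G)"
  proof -
    have "f ` S \<subseteq> f ` vs1.span (?K \<union> G)" using G(3) by blast
    also have "\<dots> = vs2.span (f ` (?K \<union> G))" by (rule span_image[symmetric])
    also have "\<dots> \<subseteq> vs2.span (f ` G)"
    proof (rule vs2.span_minimal[OF _ vs2.subspace_span])
      show "f ` (?K \<union> G) \<subseteq> vs2.span (f ` G)"
        by (auto simp: vs2.span_zero vs2.span_base)
    qed
    finally show ?thesis .
  qed
  ultimately have "vs2.dim (f ` S) = card (f ` G)"
    using image_mono[OF G(2), of f] vs2.basis_card_eq_dim[of "f ` G" "f ` S"] by simp
  then show ?thesis using dim card_image[OF inj] by simp
qed

interpretation kmap: Vector_Spaces.linear kscale kscale "mvec_map g" for g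
  unfolding Vector_Spaces.linear_iff
  by (simp add: vector_space_kscale linear_ext_add linear_ext_smult module_smult_vec kscale_def)

lemma dim_supported:
  assumes "finite T"
  shows "kvec.dim (supported T :: (nat \<Rightarrow>\<^sub>0 ('n, 'k::field) mpoly) set) = card T"
  using supported_basis[OF assms, where 'k = 'k] kvec.dim_span_eq_card_independent by metis

text \<open>Rank-nullity for the cover in the single degree \<open>j\<close>: the kernel is the
  degree \<open>j\<close> piece of the relations, the image that of \<open>M\<close>.\<close>

lemma dim_minimal_cover:
  assumes "minimal_cover d M B' d' g"
  shows "card (monom_basis B' d' j :: (nat \<times> ('n::finite \<Rightarrow>\<^sub>0 nat)) set) =
    kvec.dim (graded_piece d' j (relations B' g)) +
    kvec.dim (graded_piece d j M :: (nat \<Rightarrow>\<^sub>0 ('n, 'k::field) mpoly) set)"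
proof -
  let ?S = "graded_piece d' j (free_module B') :: (nat \<Rightarrow>\<^sub>0 ('n, 'k) mpoly) set"
  have lf: "locally_finite B' d'" and g: "\<And>b. b \<in> B' \<Longrightarrow> homogeneous_vec d (d' b) (g b)"
    and img: "mvec_map g ` free_module B' = M"
    using assms by (auto simp: minimal_cover_def)
  have fin: "finite (monom_basis B' d' j :: (nat \<times> ('n \<Rightarrow>\<^sub>0 nat)) set)" by (rule finite_monom_basis[OF lf])
  note basis = supported_basis[OF fin, where 'k = 'k, folded graded_piece_free_module]
  have "kvec.dim ?S = kvec.dim {v \<in> ?S. mvec_map g v = 0} + kvec.dim (mvec_map g ` ?S)"
  proof (rule kmap.rank_nullity)
    show "kvec.subspace ?S" by (intro kvec_subspace_graded_piece subspace_free_module)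
    show "?S \<subseteq> kvec.span ((\<lambda>(b, m). monom_vec b m 1) ` monom_basis B' d' j)" using basis(2) by simp
  qed (use fin in simp)
  moreover have "kvec.dim ?S = card (monom_basis B' d' j :: (nat \<times> ('n \<Rightarrow>\<^sub>0 nat)) set)"
    unfolding graded_piece_free_module by (rule dim_supported[OF fin])
  moreover have "{v \<in> ?S. mvec_map g v = 0} = graded_piece d' j (relations B' g)"
    by (auto simp: graded_piece_def)
  moreover have "mvec_map g ` ?S = graded_piece d j M"
  proof
    show "mvec_map g ` ?S \<subseteq> graded_piece d j M"
      using img homogeneous_vec_mvec_map[of _ B' d' j d g] g by (auto simp: graded_piece_def)
    show "graded_piece d j M \<subseteq> mvec_map g ` ?S"
    proof
      fix u assume u: "u \<in> graded_piece d j M"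
      then obtain v where v: "v \<in> free_module B'" "u = mvec_map g v"
        using img by (auto simp: graded_piece_def)
      \<comment> \<open>The preimage \<open>v\<close> need not be homogeneous; its degree
        \<open>j\<close> component maps to the same \<open>u\<close>.\<close>
      have "u = homog_part d j u"
        using u by (simp add: graded_piece_def homog_part_of_homogeneous[of d j u j])
      also have "\<dots> = mvec_map g (homog_part d' j v)"
        using homog_part_mvec_map[of v B' d d' g j] v g by simp
      finally have "u = mvec_map g (homog_part d' j v)" .
      moreover have "homog_part d' j v \<in> ?S"
        using homog_part_free_module[OF v(1)] by (simp add: graded_piece_def homogeneous_vec_homog_part)
      ultimately show "u \<in> mvec_map g ` ?S" by blast
    qed
  qed
  ultimately show ?thesis by simp
qed

text \<open>A generator of stage \<open>i + 1\<close> maps to a nonzero relation without constant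
  coefficients, so each of its terms has degree at least one above that of a generator of stage
  \<open>i\<close>.\<close>

lemma minimal_cover_shift:
  fixes g :: "nat \<Rightarrow> nat \<Rightarrow> (nat \<Rightarrow>\<^sub>0 ('n::finite, 'k::field) mpoly)"
  assumes M: "minimal_cover d\<^sub>0 M\<^sub>0 (B 0) (d 0) (g 0)"
    and c: "\<And>i. minimal_cover (d i) (relations (B i) (g i)) (B (Suc i)) (d (Suc i)) (g (Suc i))"
    and "b \<in> B i"
  shows "i \<le> d i b"
  using assms(3)
proof (induction i arbitrary: b)
  case (Suc i)
  let ?u = "g (Suc i) b"
  have u: "?u \<in> relations (B i) (g i)" by (rule minimal_cover_mem[OF c Suc.prems])
  have h: "homogeneous_vec (d i) (d (Suc i) b) ?u" using c[of i] Suc.prems by (simp add: minimal_cover_def)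
  \<comment> \<open>Otherwise the basis vector at \<open>b\<close> would be a relation with constant
    coefficient 1, against minimality of stage \<open>Suc i\<close>.\<close>
  have "?u \<noteq> 0"
  proof
    assume "?u = 0"
    let ?e = "Poly_Mapping.single b 1 :: nat \<Rightarrow>\<^sub>0 ('n, 'k) mpoly"
    have "mvec_map (g (Suc i)) ?e = 0"
      using \<open>?u = 0\<close> by (simp add: linear_ext_single[OF module_smult_vec])
    moreover have "?e \<in> free_module (B (Suc i))"
      using Suc.prems by (auto simp: mem_free_module_iff lookup_single when_def)
    ultimately have "coeff_vec ?e b 0 = 0"
      using c[of i] unfolding minimal_cover_def by blast
    then show False by simp
  qed
  then obtain b' m where nz: "coeff_vec ?u b' m \<noteq> 0" by (metis lookup_zero vec_eqI)
  have "\<exists>d' M'. minimal_cover d' M' (B i) (d i) (g i)" by (cases i) (use M c in blast)+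
  then have "coeff_vec ?u b' 0 = 0" using u unfolding minimal_cover_def by blast
  then have "monom_deg m \<noteq> 0" using nz by (auto simp: monom_deg_eq_0_iff)
  moreover have "monom_deg m + d i b' = d (Suc i) b" using h nz by (simp add: homogeneous_vec_iff)
  moreover have "b' \<in> B i" using u nz by (auto simp: mem_free_module_coeff_iff)
  ultimately show ?case using Suc.IH[of b'] by linarith
qed simp

text \<open>The resolution behind \<open>betti\<close> is an arbitrary minimal one, not the one
  constructed above, so the cover structure has to be recovered from the definition.\<close>

lemma minimal_covers_of_resolution:
  fixes I :: "('n::finite, 'k::field) mpoly set"
  assumes "minimal_graded_free_resolution F I"
  obtains g where "minimal_cover (\<lambda>_. 0) (Poly_Mapping.single 0 ` I) (gens F 0) (shift F 0) (g 0)"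
    "\<And>i. minimal_cover (shift F i) (relations (gens F i) (g i)) (gens F (Suc i)) (shift F (Suc i)) (g (Suc i))"
proof -
  \<comment> \<open>Indices shift by one: \<open>g 0\<close> is the augmentation into the rank one
    module, and \<open>g (Suc i)\<close> is the boundary map out of stage
    \<open>Suc i\<close>.\<close>
  define g where "g i = (case i of 0 \<Rightarrow> \<lambda>b. Poly_Mapping.single 0 (aug F b) | Suc i \<Rightarrow> bdry F i)" for i
  have fin: "locally_finite (gens F i) (shift F i)" for i
    using assms by (simp add: minimal_graded_free_resolution_def graded_free_resolution_def locally_finite_def)
  have hom0: "homogeneous (shift F 0 b) (aug F b)" if "b \<in> gens F 0" for b
    using assms that by (simp add: minimal_graded_free_resolution_def graded_free_resolution_def)
  have hom: "homogeneous_vec (shift F i) (shift F (Suc i) b) (bdry F i b)" if "b \<in> gens F (Suc i)" for i b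
    using assms that by (simp add: minimal_graded_free_resolution_def graded_free_resolution_def)
  have img: "aug_map F ` free_module (gens F 0) = I"
    using assms by (simp add: minimal_graded_free_resolution_def graded_free_resolution_def term_mod_def)
  have ker: "{v \<in> free_module (gens F 0). aug_map F v = 0} = bdry_map F 0 ` free_module (gens F (Suc 0))"
    using assms by (simp add: minimal_graded_free_resolution_def graded_free_resolution_def term_mod_def)
  have kers: "{v \<in> free_module (gens F (Suc i)). bdry_map F i v = 0} = bdry_map F (Suc i) ` free_module (gens F (Suc (Suc i)))" for i
    using assms by (simp add: minimal_graded_free_resolution_def graded_free_resolution_def term_mod_def)
  have min: "coeff_vec v b 0 = 0" if "v \<in> bdry_map F i ` free_module (gens F (Suc i))" for v i b
    using assms that by (auto simp: minimal_graded_free_resolution_def term_mod_def mem_graded_maximal_ideal_iff)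
  have map0: "mvec_map (g 0) v = Poly_Mapping.single 0 (aug_map F v)" for v
  proof -
    have "mvec_map (g 0) v = (\<Sum>b\<in>Poly_Mapping.keys v. Poly_Mapping.single 0 (Poly_Mapping.lookup v b * aug F b))"
      by (simp add: g_def linear_ext_def)
    also have "\<dots> = Poly_Mapping.single 0 (aug_map F v)"
      unfolding aug_map_def linear_ext_def
      by (intro poly_mapping_eqI) (simp add: lookup_sum lookup_single when_def)
    finally show ?thesis .
  qed
  have map: "mvec_map (g (Suc i)) = bdry_map F i" for i by (simp add: g_def bdry_map_def)
  have rel: "relations (gens F i) (g i) = bdry_map F i ` free_module (gens F (Suc i))" for i
  proof (cases i)
    case 0
    have "Poly_Mapping.single (0::nat) p = 0 \<longleftrightarrow> p = 0" for p :: "('n, 'k) mpoly"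
      by (metis lookup_single_eq lookup_zero single_zero)
    then show ?thesis using ker 0 by (simp add: map0)
  next
    case (Suc i)
    then show ?thesis using kers[of i] by (simp add: map)
  qed
  show thesis
  proof (rule that)
    show "minimal_cover (\<lambda>_. 0) (Poly_Mapping.single 0 ` I) (gens F 0) (shift F 0) (g 0)"
      unfolding minimal_cover_def
    proof (intro conjI ballI impI allI)
      show "homogeneous_vec (\<lambda>_. 0) (shift F 0 b) (g 0 b)" if "b \<in> gens F 0" for b
        using hom0[OF that]
        by (auto simp: g_def homogeneous_vec_iff homogeneous_def lookup_single when_def in_keys_iff)
      show "mvec_map (g 0) ` free_module (gens F 0) = Poly_Mapping.single 0 ` I"
        unfolding map0 by (simp add: img[symmetric] image_image)
      show "coeff_vec v b 0 = 0" if "v \<in> free_module (gens F 0)" "mvec_map (g 0) v = 0" for v b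
        using that rel[of 0] by (intro min[of _ 0]) blast
    qed (rule fin)
    show "minimal_cover (shift F i) (relations (gens F i) (g i)) (gens F (Suc i)) (shift F (Suc i)) (g (Suc i))" for i
      unfolding minimal_cover_def
    proof (intro conjI ballI impI allI)
      show "homogeneous_vec (shift F i) (shift F (Suc i) b) (g (Suc i) b)" if "b \<in> gens F (Suc i)" for b
        using hom[OF that] by (simp add: g_def)
      show "mvec_map (g (Suc i)) ` free_module (gens F (Suc i)) = relations (gens F i) (g i)"
        unfolding map rel ..
      show "coeff_vec v b 0 = 0" if "v \<in> free_module (gens F (Suc i))" "mvec_map (g (Suc i)) v = 0" for v b
        using that rel[of "Suc i"] by (intro min[of _ "Suc i"]) blast
    qed (rule fin)
  qed
qed

text \<open>The Hilbert function of the polynomial ring. The variables are visible only in the type,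
  hence the type argument.\<close>

definition hilbert :: "'n::finite itself \<Rightarrow> nat \<Rightarrow> nat" where
  "hilbert _ e = card {m :: 'n \<Rightarrow>\<^sub>0 nat. monom_deg m = e}"

text \<open>Grouping by the degree of the generator gives a convolution, ready to be read as a
  coefficient of a product of power series.\<close>

lemma card_monom_basis:
  assumes "locally_finite B d"
  shows "card (monom_basis B d j :: (nat \<times> ('n::finite \<Rightarrow>\<^sub>0 nat)) set) =
    (\<Sum>e\<le>j. card {b \<in> B. d b = e} * hilbert TYPE('n) (j - e))"
proof -
  let ?S = "{b \<in> B. d b \<le> j}"
  have fin: "finite ?S" by (rule locally_finite_le[OF assms])
  have "card (monom_basis B d j :: (nat \<times> ('n::finite \<Rightarrow>\<^sub>0 nat)) set) = (\<Sum>b\<in>?S. hilbert TYPE('n) (j - d b))"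
    unfolding monom_basis_def hilbert_def using fin finite_monoms_of_deg by (intro card_SigmaI) auto
  also have "\<dots> = (\<Sum>e\<le>j. \<Sum>b\<in>{b \<in> ?S. d b = e}. hilbert TYPE('n) (j - d b))"
    by (rule sum.group[symmetric]) (use fin in auto)
  also have "\<dots> = (\<Sum>e\<le>j. card {b \<in> B. d b = e} * hilbert TYPE('n) (j - e))"
  proof (rule sum.cong[OF refl])
    fix e assume "e \<in> {..j}"
    then have "{b \<in> ?S. d b = e} = {b \<in> B. d b = e}" by auto
    then show "(\<Sum>b\<in>{b \<in> ?S. d b = e}. hilbert TYPE('n) (j - d b)) = card {b \<in> B. d b = e} * hilbert TYPE('n) (j - e)"
      by simp
  qed
  finally show ?thesis .
qed

lemma hilbert_of_resolution:
  fixes I :: "('n::finite, 'k::field) mpoly set"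
  assumes F: "minimal_graded_free_resolution F I"
  defines "\<beta> \<equiv> \<lambda>i e. card {b \<in> gens F i. shift F i b = e}"
  shows "int (kvec.dim (graded_piece (\<lambda>_. 0) j (Poly_Mapping.single 0 ` I))) =
    (\<Sum>e\<le>j. (\<Sum>i\<le>e. (-1) ^ i * int (\<beta> i e)) * int (hilbert TYPE('n) (j - e)))"
proof -
  obtain g where c0: "minimal_cover (\<lambda>_. 0) (Poly_Mapping.single 0 ` I) (gens F 0) (shift F 0) (g 0)"
    and c: "\<And>i. minimal_cover (shift F i) (relations (gens F i) (g i)) (gens F (Suc i)) (shift F (Suc i)) (g (Suc i))"
    using F by (rule minimal_covers_of_resolution) blast
  have lf: "locally_finite (gens F i) (shift F i)" for i
    by (cases i) (use c0 c in \<open>auto simp: minimal_cover_def\<close>)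
  define a where "a = kvec.dim (graded_piece (\<lambda>_. 0) j (Poly_Mapping.single 0 ` I))"
  define z where "z i = kvec.dim (graded_piece (shift F i) j (relations (gens F i) (g i)))" for i
  define D where "D i = card (monom_basis (gens F i) (shift F i) j :: (nat \<times> ('n \<Rightarrow>\<^sub>0 nat)) set)" for i
  have D0: "D 0 = z 0 + a"
    unfolding D_def z_def a_def by (rule dim_minimal_cover[OF c0])
  have DS: "D (Suc i) = z (Suc i) + z i" for i
    unfolding D_def z_def by (rule dim_minimal_cover[OF c])
  have \<beta>0: "\<beta> i e = 0" if "e < i" for i e
  proof -
    have "{b \<in> gens F i. shift F i b = e} = {}"
      using minimal_cover_shift[of "\<lambda>_. 0" "Poly_Mapping.single 0 ` I" "gens F" "shift F" g, OF c0 c] that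
      by fastforce
    then show ?thesis unfolding \<beta>_def by (simp only: card.empty)
  qed
  have D: "D i = (\<Sum>e\<le>j. \<beta> i e * hilbert TYPE('n) (j - e))" for i
    unfolding D_def \<beta>_def by (rule card_monom_basis[OF lf])
  have "int a = (\<Sum>i\<le>N. (-1) ^ i * int (D i)) - (-1) ^ N * int (z N)" for N
    by (induction N) (simp_all add: D0 DS algebra_simps)
  \<comment> \<open>With \<open>D0\<close> and \<open>DS\<close> the alternating sum telescopes up
    to the error term \<open>z N\<close>. At \<open>N = j\<close> it vanishes, because the
    generators of stage \<open>j + 1\<close> all have degree above \<open>j\<close>.\<close>
  moreover have "z j = 0"
  proof -
    have "D (Suc j) = 0" unfolding D by (simp add: \<beta>0)
    then show ?thesis using DS[of j] by simp
  qed
  ultimately have "int a = (\<Sum>i\<le>j. (-1) ^ i * int (D i))" by (metis diff_zero mult_zero_right of_nat_0)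
  also have "\<dots> = (\<Sum>i\<le>j. \<Sum>e\<le>j. (-1) ^ i * int (\<beta> i e) * int (hilbert TYPE('n) (j - e)))"
    by (simp add: D sum_distrib_left mult.assoc)
  also have "\<dots> = (\<Sum>e\<le>j. \<Sum>i\<le>j. (-1) ^ i * int (\<beta> i e) * int (hilbert TYPE('n) (j - e)))"
    by (rule sum.swap)
  also have "\<dots> = (\<Sum>e\<le>j. (\<Sum>i\<le>e. (-1) ^ i * int (\<beta> i e)) * int (hilbert TYPE('n) (j - e)))"
  proof (rule sum.cong[OF refl])
    fix e assume "e \<in> {..j}"
    \<comment> \<open>Cutting the range at \<open>e\<close> removes the dependence on
      \<open>j\<close>, so that the inner sum is the coefficient of a fixed series.\<close>
    then have "(\<Sum>i\<le>j. (-1) ^ i * int (\<beta> i e)) = (\<Sum>i\<le>e. (-1) ^ i * int (\<beta> i e))"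
      by (intro sum.mono_neutral_right) (auto simp: \<beta>0)
    then show "(\<Sum>i\<le>j. (-1) ^ i * int (\<beta> i e) * int (hilbert TYPE('n) (j - e))) =
      (\<Sum>i\<le>e. (-1) ^ i * int (\<beta> i e)) * int (hilbert TYPE('n) (j - e))"
      by (simp only: sum_distrib_right[symmetric])
  qed
  finally show ?thesis by (simp add: a_def)
qed

section \<open>Counting monomials by their support\<close>

abbreviation monoms_with_support :: "'n::finite set \<Rightarrow> nat \<Rightarrow> ('n \<Rightarrow>\<^sub>0 nat) set" where
  "monoms_with_support F j \<equiv> {m. monom_deg m = j \<and> Poly_Mapping.keys m = F}"

definition support_series :: "'n::finite set \<Rightarrow> int fps" where
  "support_series F = Abs_fps (\<lambda>j. int (card (monoms_with_support F j)))"

lemma finite_monoms_with_support: "finite (monoms_with_support F j)"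
  by (rule finite_subset[OF _ finite_monoms_of_deg[of j]]) auto

lemma support_series_empty: "support_series ({} :: 'n::finite set) = 1"
proof (rule fps_ext)
  fix j
  have "monoms_with_support ({} :: 'n set) j = (if j = 0 then {0} else {})" by auto
  then show "fps_nth (support_series ({} :: 'n set)) j = fps_nth 1 j" by (simp add: support_series_def)
qed

text \<open>Dividing a monomial with support \<open>insert x F\<close> by the variable
  \<open>x\<close> leaves support \<open>insert x F\<close> or \<open>F\<close>, according to
  whether the exponent of \<open>x\<close> exceeds 1.\<close>

lemma support_series_insert:
  fixes F :: "'n::finite set"
  assumes "x \<notin> F"
  shows "(1 - fps_X) * support_series (insert x F) = fps_X * support_series F"
proof (rule fps_ext)
  fix j
  let ?s = "Poly_Mapping.single x (1::nat)"
  have "card (monoms_with_support (insert x F) (Suc i)) =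
    card (monoms_with_support (insert x F) i) + card (monoms_with_support F i)" for i
  proof -
    let ?U = "monoms_with_support (insert x F) i \<union> monoms_with_support F i"
    have "bij_betw (\<lambda>m. m + ?s) ?U (monoms_with_support (insert x F) (Suc i))"
    proof (rule bij_betw_imageI)
      show "inj_on (\<lambda>m. m + ?s) ?U" by (simp add: inj_on_def)
      show "(\<lambda>m. m + ?s) ` ?U = monoms_with_support (insert x F) (Suc i)"
      proof
        show "(\<lambda>m. m + ?s) ` ?U \<subseteq> monoms_with_support (insert x F) (Suc i)"
        proof (rule image_subsetI)
          fix m assume "m \<in> ?U"
          then have "monom_deg m = i" "Poly_Mapping.keys m = insert x F \<or> Poly_Mapping.keys m = F" by blast+
          then show "m + ?s \<in> monoms_with_support (insert x F) (Suc i)"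
            by (elim disjE) (simp_all add: monom_deg_add keys_monom_add)
        qed
        show "monoms_with_support (insert x F) (Suc i) \<subseteq> (\<lambda>m. m + ?s) ` ?U"
        proof
          fix m assume m: "m \<in> monoms_with_support (insert x F) (Suc i)"
          then have x: "Poly_Mapping.lookup m x \<noteq> 0" by (metis (mono_tags, lifting) in_keys_iff insertI1 mem_Collect_eq)
          define m' where "m' = m - ?s"
          have m': "m = m' + ?s"
            unfolding m'_def using x
            by (intro poly_mapping_eqI) (auto simp: lookup_add lookup_minus lookup_single when_def)
          have k: "insert x F = insert x (Poly_Mapping.keys m')"
            using m unfolding m' by (simp add: keys_monom_add)
          have "Poly_Mapping.keys m' = insert x F \<or> Poly_Mapping.keys m' = F"
            using k assms by (cases "x \<in> Poly_Mapping.keys m'") (auto simp: insert_absorb insert_ident)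
          moreover have "monom_deg m' = i" using m unfolding m' by (simp add: monom_deg_add)
          ultimately show "m \<in> (\<lambda>m. m + ?s) ` ?U" using m' by blast
        qed
      qed
    qed
    then have "card (monoms_with_support (insert x F) (Suc i)) = card ?U"
      by (rule bij_betw_same_card[symmetric])
    also have "\<dots> = card (monoms_with_support (insert x F) i) + card (monoms_with_support F i)"
      by (rule card_Un_disjoint) (use assms in \<open>auto simp: finite_monoms_with_support\<close>)
    finally show ?thesis .
  qed
  moreover have "card (monoms_with_support (insert x F) 0) = 0"
    by (auto simp: monom_deg_eq_0_iff card_eq_0_iff)
  ultimately show "fps_nth ((1 - fps_X) * support_series (insert x F)) j = fps_nth (fps_X * support_series F) j"
    by (cases j) (simp_all add: left_diff_distrib support_series_def)
qed

text \<open>This is (t/(1 - t))^|F| with denominators cleared by the same power for every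
  \<open>F\<close>, so that sums over faces can be compared over the integers.\<close>

lemma support_series_eq:
  fixes F :: "'n::finite set"
  shows "(1 - fps_X) ^ CARD('n) * support_series F = fps_X ^ card F * (1 - fps_X) ^ (CARD('n) - card F)"
proof -
  have "finite F" by simp
  then have *: "(1 - fps_X) ^ card F * support_series F = fps_X ^ card F"
  proof (induction F)
    case (insert x F)
    have "(1 - fps_X) ^ card (insert x F) * support_series (insert x F) =
      (1 - fps_X) ^ card F * ((1 - fps_X) * support_series (insert x F))"
      using insert by (simp add: mult_ac)
    also have "\<dots> = fps_X * ((1 - fps_X) ^ card F * support_series F)"
      unfolding support_series_insert[OF insert(2)] by (simp add: mult_ac)
    finally show ?case using insert by simp
  qed (simp add: support_series_empty)
  have "card F \<le> CARD('n)" by (rule card_mono) auto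
  then have "(1 - fps_X :: int fps) ^ CARD('n) = (1 - fps_X) ^ (CARD('n) - card F) * (1 - fps_X) ^ card F"
    by (simp flip: power_add)
  then have "(1 - fps_X) ^ CARD('n) * support_series F =
    (1 - fps_X) ^ (CARD('n) - card F) * ((1 - fps_X) ^ card F * support_series F)"
    by (simp only: mult.assoc)
  then show ?thesis unfolding * by (simp only: mult.commute)
qed

text \<open>Expanding the product of t + (1 - t) over all variables gives one summand per support.
  So (1 - t)^n inverts the Hilbert series of the ring without any formula for
  \<open>hilbert\<close>.\<close>

lemma sum_support_series_UNIV:
  "(1 - fps_X) ^ CARD('n) * (\<Sum>F\<in>UNIV. support_series (F :: 'n::finite set)) = 1"
proof -
  have "(1 - fps_X) ^ CARD('n) * (\<Sum>F\<in>UNIV. support_series (F :: 'n set)) =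
    (\<Sum>F\<in>Pow (UNIV :: 'n set). (\<Prod>x\<in>F. fps_X) * (\<Prod>x\<in>UNIV - F. 1 - fps_X))"
    by (simp add: sum_distrib_left support_series_eq card_Diff_subset)
  also have "\<dots> = (\<Prod>x\<in>(UNIV :: 'n set). fps_X + (1 - fps_X))"
    by (rule prod_add[symmetric]) simp
  finally show ?thesis by simp
qed

lemma sum_support_series_nth:
  fixes \<A> :: "'n::finite set set"
  shows "fps_nth (\<Sum>F\<in>\<A>. support_series F) j =
    int (card {m. monom_deg m = j \<and> Poly_Mapping.keys m \<in> \<A>})"
proof -
  have "{m. monom_deg m = j \<and> Poly_Mapping.keys m \<in> \<A>} = (\<Union>F\<in>\<A>. monoms_with_support F j)" by auto
  also have "card \<dots> = (\<Sum>F\<in>\<A>. card (monoms_with_support F j))"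
    by (rule card_UN_disjoint) (auto simp: finite_monoms_with_support)
  finally show ?thesis by (simp add: fps_sum_nth support_series_def)
qed

lemma one_minus_X_power_nth:
  "fps_nth ((1 - fps_X) ^ m :: int fps) m = (- 1) ^ m"
proof -
  \<comment> \<open>The degree bound is carried along because the top coefficient at
    \<open>Suc m\<close> also involves the coefficient of the previous power at
    \<open>Suc m\<close>.\<close>
  have "(\<forall>j>m. fps_nth ((1 - fps_X) ^ m :: int fps) j = 0) \<and> fps_nth ((1 - fps_X) ^ m :: int fps) m = (- 1) ^ m"
    by (induction m) (auto simp: left_diff_distrib)
  then show ?thesis by blast
qed

text \<open>The exponent n - |F| of the sign is written as n + |F|, which has the same
  parity.\<close>

lemma support_series_top_nth:
  "fps_nth ((1 - fps_X) ^ CARD('n) * support_series (F :: 'n::finite set)) CARD('n) = (- 1) ^ (CARD('n) + card F)"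
proof -
  have "card F \<le> CARD('n)" by (rule card_mono) auto
  then show ?thesis
    by (simp add: support_series_eq fps_X_power_mult_nth one_minus_X_power_nth not_less minus_one_power_iff)
qed

text \<open>A face has dimension |F| - 1, whence the global minus sign. For the void complex both
  sides are empty sums of face contributions, whatever value \<open>complex_dim\<close> has.\<close>

lemma reduced_euler_char_eq:
  fixes \<Delta> :: "'n::finite set set"
  shows "reduced_euler_char \<Delta> = - (\<Sum>F\<in>\<Delta>. (- 1) ^ card F)"
proof -
  let ?s = "\<lambda>F :: 'n set. if even (face_dim F) then 1 else - 1 :: int"
  have "reduced_euler_char \<Delta> = (\<Sum>i = -1..complex_dim \<Delta>. \<Sum>F\<in>{F \<in> \<Delta>. face_dim F = i}. ?s F)"
    by (simp add: reduced_euler_char_def face_number_def mult.commute)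
  also have "\<dots> = (\<Sum>F\<in>\<Delta>. ?s F)"
    by (rule sum.group) (auto simp: complex_dim_def face_dim_def)
  also have "\<dots> = (\<Sum>F\<in>\<Delta>. - ((- 1) ^ card F))"
    by (rule sum.cong) (auto simp: face_dim_def minus_one_power_iff)
  finally show ?thesis by (simp add: sum_negf)
qed

section \<open>The Euler characteristic in terms of Betti numbers\<close>

lemma dim_graded_piece_embedded_ideal:
  fixes I :: "('n::finite, 'k::field) mpoly set"
  assumes "squarefree_monomial_ideal I"
  shows "kvec.dim (graded_piece (\<lambda>_. 0) j (Poly_Mapping.single 0 ` I)) =
    card {m. monom_deg m = j \<and> Poly_Mapping.keys m \<in> - associated_complex I}"
proof -
  let ?A = "{m. monom_deg m = j \<and> Poly_Mapping.keys m \<in> - associated_complex I}"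
  have fin: "finite (Pair (0::nat) ` ?A)"
    by (rule finite_imageI, rule finite_subset[OF _ finite_monoms_of_deg[of j]]) auto
  have "graded_piece (\<lambda>_. 0) j (Poly_Mapping.single 0 ` I) = supported (Pair 0 ` ?A)"
    unfolding graded_piece_def supported_def mem_embedded_ideal_iff[OF assms] homogeneous_vec_iff
    by auto
  then show ?thesis by (simp only: dim_supported[OF fin]) (simp add: card_image inj_on_def)
qed

text \<open>\<open>K\<close>, \<open>H\<close> and \<open>H\<^sub>I\<close> are the Betti series,
  the Hilbert series of the ring and that of the ideal; the claim is the coefficient of t^n in
  \<open>K\<close>. The range i <= n comes from the cut-off in \<open>K\<close>.\<close>

lemma reduced_euler_char_betti:
  fixes I :: "('n::finite, 'k::field) mpoly set"
  assumes I: "squarefree_monomial_ideal I"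
  shows "reduced_euler_char (associated_complex I) =
    (\<Sum>i\<le>CARD('n). (- 1) ^ (CARD('n) + i) * int (betti I i CARD('n)))"
proof -
  define F where "F = (SOME F. minimal_graded_free_resolution F I)"
  have F: "minimal_graded_free_resolution F I"
    unfolding F_def using minimal_graded_free_resolution_exists[OF I] by (metis someI_ex)
  have betti: "betti I i j = card {b \<in> gens F i. shift F i b = j}" for i j
    by (simp add: betti_def F_def Let_def)
  let ?n = "CARD('n)"
  define \<Delta> where "\<Delta> = associated_complex I"
  define K where "K = Abs_fps (\<lambda>e. \<Sum>i\<le>e. (-1) ^ i * int (betti I i e))"
  define H where "H = (\<Sum>F\<in>UNIV. support_series (F :: 'n set))"
  define H\<^sub>I where "H\<^sub>I = (\<Sum>F\<in>- \<Delta>. support_series F)"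
  have "K * H = H\<^sub>I"
  proof (rule fps_ext)
    fix j
    have "int (hilbert TYPE('n) e) = fps_nth H e" for e
      by (simp add: H_def hilbert_def sum_support_series_nth)
    then show "fps_nth (K * H) j = fps_nth H\<^sub>I j"
      using hilbert_of_resolution[OF F, of j] dim_graded_piece_embedded_ideal[OF I, of j]
      by (simp add: fps_mult_nth K_def H\<^sub>I_def \<Delta>_def sum_support_series_nth betti atLeast0AtMost)
  qed
  then have "K = (1 - fps_X) ^ ?n * H\<^sub>I"
    using sum_support_series_UNIV[where 'n = 'n] unfolding H_def
    by (metis mult.commute mult.left_commute mult.right_neutral)
  \<comment> \<open>Passing from non-faces to faces costs the full series \<open>H\<close>, which
    contributes only the constant 1 after multiplication by (1 - t)^n.\<close>
  also have "H\<^sub>I = H - (\<Sum>F\<in>\<Delta>. support_series F)"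
    unfolding H\<^sub>I_def H_def Compl_eq_Diff_UNIV by (simp add: sum_diff)
  also have "(1 - fps_X) ^ ?n * \<dots> = 1 - (\<Sum>F\<in>\<Delta>. (1 - fps_X) ^ ?n * support_series F)"
    using sum_support_series_UNIV[where 'n = 'n] by (simp add: H_def right_diff_distrib sum_distrib_left)
  \<comment> \<open>The constant 1 drops out because \<open>CARD('n)\<close> is positive, types
    being nonempty.\<close>
  finally have "fps_nth K ?n = - (\<Sum>F\<in>\<Delta>. (- 1) ^ (?n + card F))"
    by (simp add: fps_sum_nth support_series_top_nth)
  then have "(\<Sum>i\<le>?n. (-1) ^ i * int (betti I i ?n)) = (- 1) ^ ?n * reduced_euler_char \<Delta>"
    by (simp add: K_def reduced_euler_char_eq power_add sum_distrib_left)
  then have "(- 1) ^ ?n * (\<Sum>i\<le>?n. (-1) ^ i * int (betti I i ?n)) = reduced_euler_char \<Delta>"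
    by (simp add: minus_one_power_iff)
  then show ?thesis by (simp add: \<Delta>_def sum_distrib_left power_add mult.assoc)
qed

theorem theorem2p4:
  fixes I :: "('n::finite, 'k::field) mpoly set"
    and \<Delta> :: "'n set set"
    and n r :: int
  assumes "squarefree_monomial_ideal I"
    and "\<Delta> = associated_complex I"
    and "n = int CARD('n)"
  shows
    "(regularity I \<le> ereal (of_int r) \<and> proj_dim I \<le> ereal (of_int (n - r + 1)) \<longrightarrow>
        (even r \<and> reduced_euler_char \<Delta> > 0 \<longrightarrow> regularity I = ereal (of_int r)) \<and>
        (odd r \<and> reduced_euler_char \<Delta> < 0 \<longrightarrow> regularity I = ereal (of_int r))) \<and>
     (regularity I \<le> ereal (of_int r) \<and> proj_dim I \<le> ereal (of_int (n - r)) \<longrightarrow>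
        reduced_euler_char \<Delta> \<noteq> 0 \<longrightarrow> regularity I = ereal (of_int r))"
proof -
  let ?n = "CARD('n)"
  let ?t = "\<lambda>i. (- 1) ^ (?n + i) * int (betti I i ?n)"
  have chi: "reduced_euler_char \<Delta> = (\<Sum>i\<le>?n. ?t i)"
    using reduced_euler_char_betti[OF assms(1)] assms(2) by simp
  have lower: "n - r < int i" if "regularity I < ereal (of_int r)" "betti I i ?n \<noteq> 0" for i
  proof -
    have "ereal (real ?n - real i) \<le> regularity I"
      unfolding regularity_def by (rule Sup_upper) (use that(2) in blast)
    with that(1) have "real ?n - real i < of_int r" by (metis ereal_less(1) less_ereal.simps(1) order_le_less_trans)
    then show ?thesis using assms(3) by linarith
  qed
  have upper: "int i \<le> p" if "proj_dim I \<le> ereal (of_int p)" "betti I i ?n \<noteq> 0" for i p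
  proof -
    have "ereal (real i) \<le> proj_dim I"
      unfolding proj_dim_def by (rule Sup_upper) (use that(2) in blast)
    with that(1) have "ereal (real i) \<le> ereal (of_int p)" by (rule order_trans[rotated])
    then show ?thesis by simp
  qed
  \<comment> \<open>The two bounds leave only i = n - r + 1, where n + i = 2n - r + 1 has the parity
    of r + 1. For every other index both sides are 0.\<close>
  have sign: "?t i = (if even r then - 1 else 1) * int (betti I i ?n)"
    if "regularity I < ereal (of_int r)" "proj_dim I \<le> ereal (of_int (n - r + 1))" for i
  proof (cases "betti I i ?n = 0")
    case False
    have "int i = n - r + 1" using lower[OF that(1) False] upper[OF that(2) False] by simp
    then have "int (?n + i) = 2 * n - r + 1" using assms(3) by simp
    then have "even (?n + i) \<longleftrightarrow> odd r" by presburger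
    then show ?thesis by (simp add: minus_one_power_iff)
  qed simp
  have "reduced_euler_char \<Delta> \<le> 0"
    if "regularity I < ereal (of_int r)" "proj_dim I \<le> ereal (of_int (n - r + 1))" "even r"
    unfolding chi sign[OF that(1,2)] using that(3) by (intro sum_nonpos) simp
  moreover have "reduced_euler_char \<Delta> \<ge> 0"
    if "regularity I < ereal (of_int r)" "proj_dim I \<le> ereal (of_int (n - r + 1))" "odd r"
    unfolding chi sign[OF that(1,2)] using that(3) by (intro sum_nonneg) simp
  moreover have "reduced_euler_char \<Delta> = 0"
    if "regularity I < ereal (of_int r)" "proj_dim I \<le> ereal (of_int (n - r))"
  proof -
    have "betti I i ?n = 0" for i
      using lower[OF that(1), of i] upper[OF that(2), of i] by force
    then show ?thesis unfolding chi by simp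
  qed
  \<comment> \<open>Under reg(I) <= r the only alternative to equality is reg(I) < r, and there each
    sign condition on the Euler characteristic has just been refuted.\<close>
  ultimately show ?thesis
    by (metis linorder_not_less order_le_less)
qed

end
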